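(* Let $k\ge 1$, let $m_1,\ldots,m_k$ be nonnegative integers, let $Q_{m_1},\ldots,Q_{m_k}$ be nonzero polynomials with integer coefficients with $\deg Q_{m_i}\le m_i$, let $\alpha_1,\ldots,\alpha_k>0$, and let $$w(x)=\prod_{i=1}^k |Q_{m_i}(x)|^{\alpha_i},\qquad x\in[0,1].$$ Put $\alpha:=\sum_{i=1}^k \alpha_i m_i$ and $c_w:=\mathrm{cap}([0,1],w)$. Then $$\int_1^x \psi(t)\,dt \;\ge\; \frac{-2\log c_w}{4\alpha+3}\,\frac{x^2}{2} + O(x\log^2 x)\qquad\text{as } x\to+\infty.$$
   Context: $\psi(x):=\sum_{p^m\le x}\log p$ is the Chebyshev function (sum over prime powers $p^m\le x$, $p$ prime, $m\ge1$). For a compact interval $[a,b]\subset\mathbb R$ and a nonnegative weight $w$ on $[a,b]$ (not identically zero), let $\mathcal M([a,b])$ be the set of positive unit Borel measures supported on $[a,b]$, define the weighted energy $I_w(\mu):=\iint \log\frac{1}{|z-t|\,w(z)\,w(t)}\,d\mu(z)\,d\mu(t)$, $V_w:=\inf_{\mu\in\mathcal M([a,b])} I_w(\mu)$, and the weighted capacity $\mathrm{cap}([a,b],w):=e^{-V_w}$. *)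

theory Defs
  imports "HOL-Analysis.Analysis" "HOL-Probability.Probability"
    "HOL-Computational_Algebra.Polynomial" "HOL-Library.Landau_Symbols"
begin

definition chebyshev_psi :: "real \<Rightarrow> real" where
  "chebyshev_psi x =
     (\<Sum>pm\<in>{(p::nat, m::nat). prime p \<and> m \<ge> 1 \<and> real (p ^ m) \<le> x}. ln (real (fst pm)))"

definition log_kernel :: "(real \<Rightarrow> real) \<Rightarrow> real \<times> real \<Rightarrow> ereal" where
  "log_kernel w zt =
     (let q = \<bar>fst zt - snd zt\<bar> * w (fst zt) * w (snd zt)
      in if q = 0 then \<infinity> else ereal (- ln q))"

definition ereal_integral :: "'a measure \<Rightarrow> ('a \<Rightarrow> ereal) \<Rightarrow> ereal" where
  "ereal_integral M f =
     enn2ereal (\<integral>\<^sup>+ x. e2ennreal (f x) \<partial>M) - enn2ereal (\<integral>\<^sup>+ x. e2ennreal (- f x) \<partial>M)"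

definition weighted_energy :: "(real \<Rightarrow> real) \<Rightarrow> real measure \<Rightarrow> ereal" where
  "weighted_energy w \<mu> = ereal_integral (\<mu> \<Otimes>\<^sub>M \<mu>) (log_kernel w)"

definition unit_measures_on :: "real \<Rightarrow> real \<Rightarrow> real measure set" where
  "unit_measures_on a b =
     {\<mu>. sets \<mu> = sets borel \<and> emeasure \<mu> UNIV = 1 \<and> emeasure \<mu> (- {a..b}) = 0}"

definition weighted_V :: "real \<Rightarrow> real \<Rightarrow> (real \<Rightarrow> real) \<Rightarrow> ereal" where
  "weighted_V a b w = (INF \<mu>\<in>unit_measures_on a b. weighted_energy w \<mu>)"

definition weighted_cap :: "real \<Rightarrow> real \<Rightarrow> (real \<Rightarrow> real) \<Rightarrow> real" where
  "weighted_cap a b w =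
     (case weighted_V a b w of ereal r \<Rightarrow> exp (- r) | PInfty \<Rightarrow> 0 | MInfty \<Rightarrow> 0)"

end

theory Submission
  imports Defs "HOL-Combinatorics.Permutations" "HOL-Real_Asymp.Real_Asymp"
begin

text \<open>
  Put \<open>R = \<Prod>\<^sub>i Q\<^sub>i ^ \<lceil>\<alpha>\<^sub>i n\<rceil>\<close>, of degree at most \<open>E = \<alpha> n + O(1)\<close>, and
  \<open>G(x) = \<Prod>\<^sub>i\<^sub><\<^sub>j (x\<^sub>j - x\<^sub>i) \<Prod>\<^sub>k R(x\<^sub>k)\<close>. Expanding the Vandermonde product
  shows that the integral of \<open>G\<^sup>2\<close> over the unit cube is a positive rational number whose denominator
  divides \<open>\<Prod>\<^sub>j lcm(1, ..., n + 2E + j)\<close>, \<open>j < n\<close>, so that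
  \<open>\<Sum>\<^sub>j \<psi>(n + 2E + j) \<ge> - 2 log max |G|\<close>. A Markov type inequality shows that \<open>|G|\<close> stays above half of
  its maximum when every coordinate of a maximum point moves by at most \<open>n\<close> to a fixed negative power; the
  uniform measure on the resulting \<open>n\<close> short intervals is a competitor for the weighted energy, whence
  \<open>2 log max |G| \<le> - n\<^sup>2 V\<^sub>w + O(n log n)\<close>. Thus \<open>\<psi>\<close> has integral at least
  \<open>n\<^sup>2 V\<^sub>w - O(n log n)\<close> over an interval which is \<open>[(1 + 2\<alpha>) n, (2 + 2\<alpha>) n]\<close> up to \<open>O(1)\<close>, and
  summing over a geometric sequence of such intervals gives the factor
  \<open>1 / ((2 + 2\<alpha>)\<^sup>2 - (1 + 2\<alpha>)\<^sup>2) = 1 / (4\<alpha> + 3)\<close>.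
\<close>

section \<open>The Vandermonde product\<close>

text \<open>Stated over any commutative ring because it is later evaluated at polynomials as well as
  at real numbers.\<close>

definition vandermonde :: "nat \<Rightarrow> (nat \<Rightarrow> 'a::comm_ring_1) \<Rightarrow> 'a" where
  "vandermonde n x = (\<Prod>j<n. \<Prod>i<j. x j - x i)"

text \<open>The Leibniz expansion of the determinant with entries \<open>x k ^ l\<close>. Each term
  is a product of functions of one variable, which is what allows integration over a cube coordinate
  by coordinate.\<close>

definition leibniz_vandermonde :: "nat \<Rightarrow> (nat \<Rightarrow> 'a::comm_ring_1) \<Rightarrow> 'a" where
  "leibniz_vandermonde n x =
     (\<Sum>p | p permutes {..<n}. of_int (sign p) * (\<Prod>k<n. x k ^ p k))"

text \<open>Composing with the transposition of \<open>i\<close> and \<open>j\<close> permutes the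
  summation range, keeps each monomial and flips each sign. The sum is therefore its own negative,
  hence 0 in characteristic 0.\<close>

lemma leibniz_vandermonde_eq_0:
  fixes x :: "nat \<Rightarrow> 'a::{comm_ring_1, ring_char_0, semiring_no_zero_divisors}"
  assumes "i < n" "j < n" "i \<noteq> j" "x i = x j"
  shows "leibniz_vandermonde n x = 0"
proof -
  let ?t = "Transposition.transpose i j" and ?P = "{p. p permutes {..<n}}"
  let ?f = "\<lambda>p. of_int (sign p) * (\<Prod>k<n. x k ^ p k) :: 'a"
  have t: "?t permutes {..<n}"
    using assms by (intro permutes_swap_id) auto
  have xt: "x (?t k) = x k" for k
    using assms(4) by (auto simp: Transposition.transpose_def)
  have bij: "bij_betw (\<lambda>p. p \<circ> ?t) ?P ?P"
    by (intro bij_betw_byWitness[where f' = "\<lambda>p. p \<circ> ?t"])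
       (auto simp: o_assoc[symmetric] intro: permutes_compose[OF t])
  have f: "?f (p \<circ> ?t) = - ?f p" if "p permutes {..<n}" for p
  proof -
    have "sign (p \<circ> ?t) = - sign p"
      using that t assms(3)
      by (subst sign_compose) (auto simp: sign_swap_id permutation_permutes intro!: permutation_swap_id)
    moreover have "(\<Prod>k<n. x k ^ (p \<circ> ?t) k) = (\<Prod>k<n. x k ^ p k)"
      by (rule prod.reindex_bij_betw[OF permutes_imp_bij[OF t], of "\<lambda>k. x k ^ p k", simplified xt,
            folded o_apply[of p ?t]])
    ultimately show ?thesis by simp
  qed
  have "leibniz_vandermonde n x = (\<Sum>p\<in>?P. ?f (p \<circ> ?t))"
    unfolding leibniz_vandermonde_def by (rule sum.reindex_bij_betw[OF bij, symmetric])
  also have "\<dots> = (\<Sum>p\<in>?P. - ?f p)"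
    using f by (intro sum.cong) auto
  also have "\<dots> = - leibniz_vandermonde n x"
    by (simp add: leibniz_vandermonde_def sum_negf)
  finally show ?thesis by (simp add: eq_neg_iff_add_eq_0 flip: mult_2)
qed

lemma permutes_lessThan_Suc_fixing:
  "{p. p permutes {..<Suc n} \<and> p n = n} = {p. p permutes {..<n}}"
proof (safe)
  fix p assume p: "p permutes {..<Suc n}" "p n = n"
  show "p permutes {..<n}"
    using permutes_superset[OF p(1)] p(2) by (auto simp: less_Suc_eq)
next
  fix p assume p: "p permutes {..<n}"
  then show "p permutes {..<Suc n}" by (rule permutes_subset) auto
  show "p n = n" using p by (auto simp: permutes_def)
qed

text \<open>Both sides, as polynomials in \<open>x\<^sub>n\<close> of degree at most \<open>n\<close>, have the same leading coefficient by
  induction and the \<open>n\<close> common roots \<open>x\<^sub>0, ..., x\<^sub>n\<^sub>-\<^sub>1\<close>.\<close>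

lemma vandermonde_leibniz:
  fixes x :: "nat \<Rightarrow> 'a::{idom, ring_char_0}"
  shows "vandermonde n x = leibniz_vandermonde n x"
proof (induction n)
  case 0
  show ?case by (simp add: vandermonde_def leibniz_vandermonde_def)
next
  case (Suc n)
  show ?case
  proof (cases "inj_on x {..<n}")
    \<comment> \<open>The root count of the other case needs distinct points. With a repetition both
      sides vanish, the left one through the induction hypothesis.\<close>
    case False
    then obtain i j where ij: "i < n" "j < n" "i \<noteq> j" "x i = x j"
      by (auto simp: inj_on_def)
    have "leibniz_vandermonde (Suc n) x = 0"
      using ij by (intro leibniz_vandermonde_eq_0[of i _ j]) auto
    moreover have "vandermonde (Suc n) x = 0"
      using Suc.IH leibniz_vandermonde_eq_0[OF ij] by (simp add: vandermonde_def)
    ultimately show ?thesis by simp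
  next
    case inj: True
    let ?c = "\<lambda>p. of_int (sign p) * (\<Prod>k<n. x k ^ p k) :: 'a"
    define q where "q = (\<Sum>p | p permutes {..<Suc n}. monom (?c p) (p n))"
    define r where "r = smult (vandermonde n x) (\<Prod>i<n. [:- x i, 1:])"
    have q: "poly q t = leibniz_vandermonde (Suc n) (x(n := t))" for t
      by (simp add: q_def leibniz_vandermonde_def poly_sum poly_monom mult.assoc)
    have r: "poly r t = vandermonde n x * (\<Prod>i<n. t - x i)" for t
      by (simp add: r_def poly_prod)
    have roots: "poly (q - r) (x i) = 0" if "i < n" for i
    proof -
      have "poly q (x i) = 0"
        unfolding q using that by (intro leibniz_vandermonde_eq_0[of i _ n]) auto
      moreover have "poly r (x i) = 0"
        unfolding r using that by auto
      ultimately show ?thesis by simp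
    qed
    have fin: "finite {p. p permutes {..<Suc n}}" by (rule finite_permutations) auto
    have "degree (\<Prod>i<n. [:- x i, 1:]) = n" 
      by (subst degree_prod_sum_eq) auto
    moreover have "lead_coeff (\<Prod>i<n. [:- x i, 1:]) = 1"
      by (subst lead_coeff_prod) auto
    ultimately have cr: "coeff r n = vandermonde n x" and dr: "degree r \<le> n"
      by (auto simp: r_def intro: order.trans[OF degree_smult_le])
    have dq: "degree q \<le> n"
      unfolding q_def
    proof (intro degree_sum_le fin)
      fix p assume "p \<in> {p. p permutes {..<Suc n}}"
      then have "p n < Suc n" using permutes_in_image[of p "{..<Suc n}" n] by auto
      then show "degree (monom (?c p) (p n)) \<le> n"
        by (intro order.trans[OF degree_monom_le]) auto
    qed
    \<comment> \<open>The top coefficient collects the permutations that fix \<open>n\<close>, which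
      are the permutations of \<open>{..<n}\<close>.\<close>
    have "coeff q n = (\<Sum>p | p permutes {..<Suc n} \<and> p n = n. ?c p)"
      using fin by (auto simp: q_def coeff_sum sum.If_cases Int_def
            intro!: sum.mono_neutral_cong_right)
    also have "\<dots> = vandermonde n x"
      using Suc.IH by (simp add: permutes_lessThan_Suc_fixing leibniz_vandermonde_def)
    finally have cq: "coeff q n = vandermonde n x" .
    have "q - r = 0"
    proof (rule ccontr)
      assume nz: "q - r \<noteq> 0"
      have "degree (q - r) \<le> n"
        using dq dr by (rule degree_diff_le)
      moreover have "degree (q - r) \<noteq> n"
        using nz cq cr by (metis leading_coeff_0_iff coeff_diff diff_self)
      ultimately have "degree (q - r) < n" by simp
      moreover have "n \<le> card {t. poly (q - r) t = 0}"
      proof -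
        have "card (x ` {..<n}) \<le> card {t. poly (q - r) t = 0}"
          using roots nz by (intro card_mono poly_roots_finite) auto
        then show ?thesis using inj by (simp add: card_image)
      qed
      moreover have "card {t. poly (q - r) t = 0} \<le> degree (q - r)"
        using nz by (rule card_poly_roots_bound)
      ultimately show False by simp
    qed
    then have "poly q (x n) = poly r (x n)" by simp
    then show ?thesis
      unfolding q r by (simp add: vandermonde_def)
  qed
qed

section \<open>Chebyshev's function and least common multiples\<close>

definition prime_power_pairs :: "real \<Rightarrow> (nat \<times> nat) set" where
  "prime_power_pairs x = {(p, m). prime p \<and> m \<ge> 1 \<and> real (p ^ m) \<le> x}"

text \<open>The least common multiple of \<open>1, ..., N\<close>, as a product over prime powers so that its
  logarithm is visibly \<open>\<psi>(N)\<close>; only divisibility by \<open>1, ..., N\<close> is needed.\<close>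

definition psi_lcm :: "nat \<Rightarrow> nat" where
  "psi_lcm N = (\<Prod>(p, m)\<in>prime_power_pairs (real N). p)"

lemma finite_prime_power_pairs: "finite (prime_power_pairs x)"
proof (rule finite_subset)
  show "prime_power_pairs x \<subseteq> {..nat \<lfloor>x\<rfloor>} \<times> {..nat \<lfloor>x\<rfloor>}"
  proof (rule subrelI)
    fix p m assume "(p, m) \<in> prime_power_pairs x"
    then have pm: "prime p" "m \<ge> 1" "real (p ^ m) \<le> x"
      by (auto simp: prime_power_pairs_def)
    have "p ^ 1 \<le> p ^ m" using pm prime_ge_1_nat by (intro power_increasing) auto
    moreover have "m < p ^ m" using prime_gt_1_nat[OF pm(1)] by (intro power_gt_expt) auto
    moreover have "p ^ m \<le> nat \<lfloor>x\<rfloor>"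
      using pm(3) by (simp add: le_nat_floor)
    ultimately show "(p, m) \<in> {..nat \<lfloor>x\<rfloor>} \<times> {..nat \<lfloor>x\<rfloor>}" by auto
  qed
qed auto

lemma chebyshev_psi_altdef: "chebyshev_psi x = (\<Sum>(p, m)\<in>prime_power_pairs x. ln (real p))"
  by (simp add: chebyshev_psi_def prime_power_pairs_def case_prod_unfold)

lemma chebyshev_psi_nonneg: "chebyshev_psi x \<ge> 0"
  unfolding chebyshev_psi_altdef
  by (intro sum_nonneg) (auto simp: prime_power_pairs_def intro!: ln_ge_zero dest: prime_ge_1_nat)

lemma chebyshev_psi_mono: "x \<le> y \<Longrightarrow> chebyshev_psi x \<le> chebyshev_psi y"
  unfolding chebyshev_psi_altdef using finite_prime_power_pairs
  by (intro sum_mono2) (auto simp: prime_power_pairs_def intro!: ln_ge_zero dest: prime_ge_1_nat)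

lemma psi_lcm_pos: "psi_lcm N > 0"
  unfolding psi_lcm_def by (intro prod_pos) (auto simp: prime_power_pairs_def prime_gt_0_nat)

lemma ln_psi_lcm: "ln (real (psi_lcm N)) = chebyshev_psi (real N)"
  unfolding psi_lcm_def chebyshev_psi_altdef of_nat_prod
  using finite_prime_power_pairs[of "real N"]
  by (subst ln_prod) (auto simp: prime_power_pairs_def case_prod_unfold prime_gt_0_nat)

text \<open>The factorisation of \<open>d\<close> is the product of \<open>p\<close> over the pairs
  \<open>(p, m)\<close> with \<open>m\<close> from 1 to the multiplicity of \<open>p\<close>. Each
  such \<open>p ^ m\<close> divides \<open>d\<close>, so it is at most \<open>N\<close>, and
  \<open>d\<close> is a subproduct of \<open>psi_lcm N\<close>.\<close>

lemma dvd_psi_lcm: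
  assumes "1 \<le> d" "d \<le> N"
  shows "d dvd psi_lcm N"
proof -
  let ?S = "SIGMA p:prime_factors d. {1..multiplicity p d}"
  have "d = (\<Prod>p\<in>prime_factors d. p ^ multiplicity p d)"
    using assms prod_prime_factors[of d] by auto
  also have "\<dots> = (\<Prod>p\<in>prime_factors d. \<Prod>m\<in>{1..multiplicity p d}. p)"
    by simp
  also have "\<dots> = (\<Prod>(p, m)\<in>?S. p)"
    by (rule prod.Sigma) auto
  finally have d: "d = (\<Prod>(p, m)\<in>?S. p)" .
  have "?S \<subseteq> prime_power_pairs (real N)"
  proof safe
    fix p m assume p: "p \<in> prime_factors d" and m: "m \<in> {1..multiplicity p d}"
    have "p ^ m dvd d" using m by (intro multiplicity_dvd') auto
    then have "p ^ m \<le> N" using assms by (auto dest!: dvd_imp_le)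
    then show "(p, m) \<in> prime_power_pairs (real N)"
      using p m by (auto simp: prime_power_pairs_def simp del: of_nat_power)
  qed
  then show ?thesis
    using d finite_prime_power_pairs unfolding psi_lcm_def
    by (metis (no_types, lifting) prod_dvd_prod_subset)
qed

section \<open>Moments of integer polynomials on the unit interval\<close>

lemma poly_altdef_bound:
  fixes p :: "'a::comm_semiring_1 poly"
  assumes "degree p \<le> D"
  shows "poly p x = (\<Sum>j\<le>D. coeff p j * x ^ j)"
  unfolding poly_altdef using assms by (intro sum.mono_neutral_left) (auto simp: coeff_eq_0)

text \<open>Integrating \<open>x ^ (a + j)\<close> gives the denominator \<open>a + j + 1\<close>,
  and the strict inequality \<open>a + D < N\<close> says exactly that all these denominators are at
  most \<open>N\<close>.\<close>

lemma psi_lcm_times_moment_Ints: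
  fixes p :: "int poly"
  assumes "degree p \<le> D" "a + D < N"
  shows "real (psi_lcm N) * integral {0..1} (\<lambda>x. x ^ a * poly (map_poly real_of_int p) x) \<in> \<int>"
proof -
  have "((\<lambda>x. \<Sum>j\<le>D. of_int (coeff p j) * x ^ (a + j)) has_integral
         (\<Sum>j\<le>D. of_int (coeff p j) * (1 / real (Suc (a + j))))) {0..1::real}"
  proof (intro has_integral_sum has_integral_mult_right finite_atMost)
    fix j
    have "((\<lambda>x. x ^ (a + j)) has_integral (1 ^ Suc (a + j) / real (Suc (a + j)) - 0 ^ Suc (a + j) / real (Suc (a + j)))) {0..1::real}"
    proof (intro fundamental_theorem_of_calculus)
      fix x :: real
      show "((\<lambda>x. x ^ Suc (a + j) / real (Suc (a + j))) has_vector_derivative x ^ (a + j)) (at x within {0..1})"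
        using DERIV_cdivide[OF DERIV_pow[of "Suc (a + j)" x "{0..1}"], of "real (Suc (a + j))"]
        by (simp add: has_real_derivative_iff_has_vector_derivative del: power_Suc of_nat_Suc)
    qed auto
    then show "((\<lambda>x. x ^ (a + j)) has_integral 1 / real (Suc (a + j))) {0..1::real}" by simp
  qed
  then have "integral {0..1} (\<lambda>x. x ^ a * poly (map_poly real_of_int p) x) =
       (\<Sum>j\<le>D. of_int (coeff p j) * (1 / real (Suc (a + j))))"
    using assms(1)
    by (subst poly_altdef_bound[of _ D])
       (auto simp: sum_distrib_left power_add mult_ac coeff_map_poly
             intro!: integral_unique order.trans[OF map_poly_degree_leq])
  then have "real (psi_lcm N) * integral {0..1} (\<lambda>x. x ^ a * poly (map_poly real_of_int p) x) =
      (\<Sum>j\<le>D. of_int (coeff p j) * (real (psi_lcm N) / real (Suc (a + j))))"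
    by (simp add: sum_distrib_left mult_ac)
  also have "\<dots> \<in> \<int>"
  proof (intro Ints_sum Ints_mult Ints_of_int)
    fix j assume "j \<in> {..D}"
    then have "Suc (a + j) dvd psi_lcm N"
      using assms(2) by (intro dvd_psi_lcm) auto
    then obtain c where "psi_lcm N = Suc (a + j) * c" by (auto elim: dvdE)
    then show "real (psi_lcm N) / real (Suc (a + j)) \<in> \<int>"
      by (simp del: of_nat_Suc mult_Suc)
  qed
  finally show ?thesis .
qed

section \<open>Integrals of the Chebyshev function\<close>

lemma chebyshev_psi_integrable: "chebyshev_psi integrable_on {a..b}"
  by (rule integrable_on_mono_on) (auto simp: mono_on_def chebyshev_psi_mono)

text \<open>By monotonicity each value is at most the integral over the unit interval to its
  right.\<close>

lemma sum_chebyshev_psi_le_integral: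
  "(\<Sum>j<n. chebyshev_psi (a + real j)) \<le> integral {a..a + real n} chebyshev_psi"
proof (induction n)
  case (Suc n)
  have "chebyshev_psi (a + real n) = integral {a + real n..a + real (Suc n)} (\<lambda>_. chebyshev_psi (a + real n))"
    by simp
  also have "\<dots> \<le> integral {a + real n..a + real (Suc n)} chebyshev_psi"
    by (intro integral_le chebyshev_psi_integrable) (auto intro: chebyshev_psi_mono)
  also have "integral {a..a + real n} chebyshev_psi + \<dots> = integral {a..a + real (Suc n)} chebyshev_psi"
    by (intro Henstock_Kurzweil_Integration.integral_combine chebyshev_psi_integrable) auto
  ultimately show ?case using Suc by simp
qed auto

section \<open>A Markov type inequality\<close>

text \<open>Even trigonometric polynomials: the form taken by polynomials of degree at most
  \<open>N\<close> under the substitution y = cos t.\<close>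

definition cosine_polynomial :: "nat \<Rightarrow> (real \<Rightarrow> real) \<Rightarrow> bool" where
  "cosine_polynomial N f \<longleftrightarrow> (\<exists>a. \<forall>t. f t = (\<Sum>k\<le>N. a k * cos (real k * t)))"

lemma cosine_polynomial_cos:
  assumes "k \<le> N"
  shows "cosine_polynomial N (\<lambda>t. cos (real k * t))"
  unfolding cosine_polynomial_def using assms
  by (intro exI[of _ "\<lambda>j. if j = k then 1 else 0"]) (simp add: mult_delta_left)

lemma cosine_polynomial_cmult:
  assumes "cosine_polynomial N f"
  shows "cosine_polynomial N (\<lambda>t. c * f t)"
proof -
  obtain a where "\<And>t. f t = (\<Sum>k\<le>N. a k * cos (real k * t))"
    using assms by (auto simp: cosine_polynomial_def)
  then show ?thesis unfolding cosine_polynomial_def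
    by (intro exI[of _ "\<lambda>k. c * a k"]) (simp add: sum_distrib_left mult_ac)
qed

lemma cosine_polynomial_add:
  assumes "cosine_polynomial N f" "cosine_polynomial N g"
  shows "cosine_polynomial N (\<lambda>t. f t + g t)"
proof -
  obtain a b where "\<And>t. f t = (\<Sum>k\<le>N. a k * cos (real k * t))"
    "\<And>t. g t = (\<Sum>k\<le>N. b k * cos (real k * t))"
    using assms by (auto simp: cosine_polynomial_def)
  then show ?thesis unfolding cosine_polynomial_def
    by (intro exI[of _ "\<lambda>k. a k + b k"]) (simp add: sum.distrib algebra_simps)
qed

lemma cosine_polynomial_sum:
  assumes "finite I" "\<And>i. i \<in> I \<Longrightarrow> cosine_polynomial N (f i)"
  shows "cosine_polynomial N (\<lambda>t. \<Sum>i\<in>I. f i t)"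
  using assms
proof (induction I rule: finite_induct)
  case empty
  show ?case by (auto simp: cosine_polynomial_def intro: exI[of _ "\<lambda>_. 0"])
qed (simp add: cosine_polynomial_add)

lemma cosine_polynomial_cos_power:
  "n \<le> N \<Longrightarrow> cosine_polynomial N (\<lambda>t. cos t ^ n)"
proof (induction n arbitrary: N)
  case 0
  show ?case using cosine_polynomial_cos[of 0 N] by simp
next
  case (Suc n)
  obtain a where a: "\<And>t. cos t ^ n = (\<Sum>k\<le>n. a k * cos (real k * t))"
    using Suc.IH[of n] by (auto simp: cosine_polynomial_def)
  \<comment> \<open>For \<open>k = 0\<close> the frequency is -1, which evenness of the cosine turns
    into 1; truncated subtraction would give 0.\<close>
  have cos_nat_diff: "cos (real k * t - t) = cos (real (if k = 0 then 1 else k - 1) * t)" for k t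
    by (cases k) (auto simp: algebra_simps)
  have "cos t ^ Suc n = (\<Sum>k\<le>n. a k / 2 * (cos (real (k + 1) * t)
            + cos (real (if k = 0 then 1 else k - 1) * t)))" for t
    unfolding power_Suc a cos_nat_diff[symmetric] sum_distrib_left
    by (intro sum.cong) (auto simp: ring_distribs cos_add cos_diff)
  moreover have "cosine_polynomial N (\<lambda>t. \<Sum>k\<le>n. a k / 2 * (cos (real (k + 1) * t)
            + cos (real (if k = 0 then 1 else k - 1) * t)))"
    using Suc.prems by (intro cosine_polynomial_sum cosine_polynomial_cmult cosine_polynomial_add
      cosine_polynomial_cos) auto
  ultimately show ?case by simp
qed

lemma cosine_polynomial_poly:
  assumes "degree p \<le> N"
  shows "cosine_polynomial N (\<lambda>t. poly p (cos t))"
  unfolding poly_altdef using assms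
  by (intro cosine_polynomial_sum cosine_polynomial_cmult cosine_polynomial_cos_power) auto

lemma integral_cos_period:
  assumes "m \<noteq> (0::int)"
  shows "((\<lambda>t. cos (of_int m * t)) has_integral 0) {0..2 * pi}"
proof -
  have "((\<lambda>t. cos (of_int m * t)) has_integral
      (sin (of_int m * (2 * pi)) / of_int m - sin (of_int m * 0) / of_int m)) {0..2 * pi}"
    using assms
    by (intro fundamental_theorem_of_calculus)
       (auto intro!: derivative_eq_intros simp flip: has_real_derivative_iff_has_vector_derivative)
  moreover have "sin (of_int m * (2 * pi)) = 0"
    using sin_int_2pin[of m] by (simp add: mult_ac)
  ultimately show ?thesis by simp
qed

text \<open>Orthogonality of the cosines over a period. The assumption on \<open>k\<close> keeps the
  frequency \<open>j + k\<close> nonzero, so that only \<open>j - k\<close> can contribute.\<close>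

lemma integral_cos_cos:
  assumes "k \<noteq> 0"
  shows "((\<lambda>t. cos (real j * t) * cos (real k * t)) has_integral (if j = k then pi else 0)) {0..2 * pi}"
proof -
  have e: "cos (real j * t) * cos (real k * t) =
      1 / 2 * cos (of_int (int j - int k) * t) + 1 / 2 * cos (of_int (int j + int k) * t)" for t
    by (simp add: ring_distribs cos_add cos_diff)
  have sum: "((\<lambda>t. cos (of_int (int j + int k) * t)) has_integral 0) {0..2 * pi}"
    using assms by (intro integral_cos_period) auto
  have diff: "((\<lambda>t. cos (of_int (int j - int k) * t)) has_integral (if j = k then 2 * pi else 0)) {0..2 * pi}"
    using integral_cos_period[of "int j - int k"] has_integral_const_real[of "1::real" 0 "2 * pi"]
    by auto
  show ?thesis
    unfolding e
    using has_integral_add[OF has_integral_mult_right[OF diff, of "1 / 2"] has_integral_mult_right[OF sum, of "1 / 2"]]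
    by (auto split: if_splits)
qed

text \<open>Polynomial dependence on the degree suffices below, so the Lipschitz constant of \<open>p(cos t)\<close> is
  estimated crudely, coefficient by coefficient.\<close>

lemma cosine_coefficient_bound:
  assumes f: "\<And>t. f t = (\<Sum>j\<le>N. a j * cos (real j * t))"
    and M: "\<And>t. \<bar>f t\<bar> \<le> M" and k: "k \<noteq> 0" "k \<le> N"
  shows "\<bar>a k\<bar> \<le> 2 * M"
proof -
  have "((\<lambda>t. \<Sum>j\<le>N. a j * (cos (real j * t) * cos (real k * t))) has_integral
          (\<Sum>j\<le>N. a j * (if j = k then pi else 0))) {0..2 * pi}"
    by (intro has_integral_sum has_integral_mult_right integral_cos_cos k finite_atMost)
  moreover have "(\<lambda>t. \<Sum>j\<le>N. a j * (cos (real j * t) * cos (real k * t))) = (\<lambda>t. f t * cos (real k * t))"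
    by (simp add: f sum_distrib_right mult.assoc)
  moreover have "(\<Sum>j\<le>N. a j * (if j = k then pi else 0)) = a k * pi"
    using k by (simp add: if_distrib cong: if_cong)
  ultimately have "((\<lambda>t. f t * cos (real k * t)) has_integral (a k * pi)) (cbox 0 (2 * pi))"
    by simp
  \<comment> \<open>The integral is at most \<open>M\<close> times the length \<open>2 * pi\<close>
    of the interval; dividing by \<open>pi\<close> leaves the factor 2.\<close>
  then have "norm (a k * pi) \<le> M * measure lborel (cbox 0 (2 * pi))"
  proof (rule has_integral_bound[rotated])
    show "0 \<le> M" using M[of 0] by linarith
    fix t
    have "\<bar>f t\<bar> * \<bar>cos (real k * t)\<bar> \<le> M * 1"
      using M[of t] by (intro mult_mono) auto
    then show "norm (f t * cos (real k * t)) \<le> M" by (simp add: abs_mult)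
  qed
  then show ?thesis by (simp add: abs_mult)
qed

lemma abs_sin_mult_le: "\<bar>sin (real k * x)\<bar> \<le> real k * \<bar>sin x\<bar>"
proof (induction k)
  case (Suc k)
  have "sin (real (Suc k) * x) = sin (real k * x) * cos x + cos (real k * x) * sin x"
    by (simp add: algebra_simps sin_add)
  then have "\<bar>sin (real (Suc k) * x)\<bar> \<le> \<bar>sin (real k * x)\<bar> * \<bar>cos x\<bar> + \<bar>cos (real k * x)\<bar> * \<bar>sin x\<bar>"
    by (metis abs_mult abs_triangle_ineq)
  also have "\<dots> \<le> \<bar>sin (real k * x)\<bar> * 1 + 1 * \<bar>sin x\<bar>"
    by (intro add_mono mult_mono) auto
  finally show ?case using Suc by (simp add: algebra_simps)
qed auto

text \<open>The difference of cosines is twice a product of two sines, and each sine loses a factor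
  \<open>k\<close>. Comparing with the difference of cos s and cos t, not of s and t, makes the
  bound pass to algebraic polynomials without loss near the endpoints.\<close>

lemma abs_cos_mult_diff_le: "\<bar>cos (real k * s) - cos (real k * t)\<bar> \<le> (real k)\<^sup>2 * \<bar>cos s - cos t\<bar>"
proof -
  have "\<bar>cos (real k * s) - cos (real k * t)\<bar> =
      2 * (\<bar>sin (real k * ((s + t) / 2))\<bar> * \<bar>sin (real k * ((t - s) / 2))\<bar>)"
    unfolding cos_diff_cos by (simp add: abs_mult algebra_simps diff_divide_distrib add_divide_distrib)
  also have "\<dots> \<le> 2 * ((real k * \<bar>sin ((s + t) / 2)\<bar>) * (real k * \<bar>sin ((t - s) / 2)\<bar>))"
    by (intro mult_left_mono mult_mono abs_sin_mult_le) auto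
  also have "\<dots> = (real k)\<^sup>2 * \<bar>cos s - cos t\<bar>"
    unfolding cos_diff_cos by (simp add: abs_mult power2_eq_square)
  finally show ?thesis .
qed

text \<open>There are \<open>N + 1\<close> terms, with coefficients at most \<open>2 * M\<close> and
  differences costing at most the square of \<open>N + 1\<close>. The constant term, which the
  coefficient bound excludes, cancels.\<close>

lemma poly_cos_lipschitz:
  assumes "degree p \<le> N" and M: "\<And>y. \<bar>y\<bar> \<le> 1 \<Longrightarrow> \<bar>poly p y\<bar> \<le> M"
  shows "\<bar>poly p (cos s) - poly p (cos t)\<bar> \<le> 2 * M * (real N + 1) ^ 3 * \<bar>cos s - cos t\<bar>"
proof -
  obtain a where a: "\<And>t. poly p (cos t) = (\<Sum>k\<le>N. a k * cos (real k * t))"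
    using cosine_polynomial_poly[OF assms(1)] by (auto simp: cosine_polynomial_def)
  have M0: "M \<ge> 0" using M[of 0] by simp
  have ak: "\<bar>a k\<bar> \<le> 2 * M" if "k \<noteq> 0" "k \<le> N" for k
    using that by (intro cosine_coefficient_bound[OF a, of M k] M abs_cos_le_one)
  have "poly p (cos s) - poly p (cos t) = (\<Sum>k\<le>N. a k * (cos (real k * s) - cos (real k * t)))"
    by (simp add: a sum_subtractf algebra_simps)
  also have "\<bar>\<dots>\<bar> \<le> (\<Sum>k\<le>N. 2 * M * ((real N + 1)\<^sup>2 * \<bar>cos s - cos t\<bar>))"
  proof (intro order.trans[OF sum_abs] sum_mono)
    fix k assume k: "k \<in> {..N}"
    show "\<bar>a k * (cos (real k * s) - cos (real k * t))\<bar> \<le> 2 * M * ((real N + 1)\<^sup>2 * \<bar>cos s - cos t\<bar>)"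
    proof (cases "k = 0")
      case False
      have "(real k)\<^sup>2 * \<bar>cos s - cos t\<bar> \<le> (real N + 1)\<^sup>2 * \<bar>cos s - cos t\<bar>"
        using k by (intro mult_right_mono power_mono) auto
      then show ?thesis unfolding abs_mult
        using k False M0
        by (intro mult_mono ak order.trans[OF abs_cos_mult_diff_le]) auto
    qed (use M0 in simp)
  qed
  also have "\<dots> = 2 * M * (real N + 1) ^ 3 * \<bar>cos s - cos t\<bar>"
    by (simp add: power2_eq_square power3_eq_cube algebra_simps)
  finally show ?thesis .
qed

text \<open>Transport to [-1, 1] by u = 2x - 1, which doubles distances. The cubic power replaces
  the quadratic growth in Markov's inequality; only its logarithm enters the final error.\<close>

lemma poly_lipschitz_unit_interval:
  fixes p :: "real poly"
  assumes "degree p \<le> N" and M: "\<And>y. y \<in> {0..1} \<Longrightarrow> \<bar>poly p y\<bar> \<le> M"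
    and "x \<in> {0..1}" "y \<in> {0..1}"
  shows "\<bar>poly p x - poly p y\<bar> \<le> 4 * M * (real N + 1) ^ 3 * \<bar>x - y\<bar>"
proof -
  let ?q = "pcompose p [:1/2, 1/2:]"
  have "degree ?q \<le> N" using assms(1) by (simp add: degree_pcompose)
  moreover have "\<bar>poly ?q u\<bar> \<le> M" if "\<bar>u\<bar> \<le> 1" for u
    using M[of "1 / 2 + u / 2"] that by (auto simp: poly_pcompose abs_le_iff)
  ultimately have "\<bar>poly ?q (cos (arccos (2 * x - 1))) - poly ?q (cos (arccos (2 * y - 1)))\<bar>
     \<le> 2 * M * (real N + 1) ^ 3 * \<bar>cos (arccos (2 * x - 1)) - cos (arccos (2 * y - 1))\<bar>"
    by (rule poly_cos_lipschitz)
  moreover have "cos (arccos (2 * x - 1)) = 2 * x - 1" "cos (arccos (2 * y - 1)) = 2 * y - 1"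
    using assms by (auto intro!: cos_arccos)
  moreover have "poly ?q (2 * z - 1) = poly p z" for z
    by (simp add: poly_pcompose diff_divide_distrib)
  moreover have "\<bar>2 * x - 1 - (2 * y - 1)\<bar> = 2 * \<bar>x - y\<bar>" by (simp add: abs_if)
  ultimately show ?thesis
    by (simp only: mult_ac)
qed

section \<open>Uniform measures on short intervals\<close>

definition unif :: "real \<Rightarrow> real \<Rightarrow> real measure" where
  "unif a e = density lborel (\<lambda>x. ennreal (indicator {a..a+e} x / e))"

lemma sets_unif [measurable_cong, simp]: "sets (unif a e) = sets borel"
  and space_unif [simp]: "space (unif a e) = UNIV"
  by (simp_all add: unif_def)

lemma prob_space_unif:
  assumes "e > 0"
  shows "prob_space (unif a e)"
proof (rule prob_spaceI)
  have "emeasure (unif a e) (space (unif a e)) = (\<integral>\<^sup>+x. ennreal (1 / e) * indicator {a..a+e} x \<partial>lborel)"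
    unfolding unif_def using assms
    by (subst emeasure_density) (auto intro!: nn_integral_cong split: split_indicator)
  also have "\<dots> = ennreal (1 / e) * ennreal e"
    using assms by (subst nn_integral_cmult_indicator) auto
  also have "\<dots> = 1"
    using assms by (simp flip: ennreal_mult)
  finally show "emeasure (unif a e) (space (unif a e)) = 1" .
qed

lemma AE_unif: "e > 0 \<Longrightarrow> AE x in unif a e. x \<in> {a..a+e}"
  unfolding unif_def by (subst AE_density) (auto split: split_indicator)

lemma AE_unif_pair:
  assumes "d > 0" "e > 0"
  shows "AE p in unif a d \<Otimes>\<^sub>M unif b e. fst p \<in> {a..a+d} \<and> snd p \<in> {b..b+e}"
proof -
  interpret U: prob_space "unif a d" by (rule prob_space_unif) fact
  interpret V: prob_space "unif b e" by (rule prob_space_unif) fact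
  interpret UV: pair_prob_space "unif a d" "unif b e" ..
  show ?thesis
  proof (rule UV.AE_pair_measure)
    from AE_unif[OF assms(1), of a]
    show "AE x in unif a d. AE y in unif b e. fst (x, y) \<in> {a..a+d} \<and> snd (x, y) \<in> {b..b+e}"
    proof (rule eventually_mono)
      fix x assume x: "x \<in> {a..a+d}"
      from AE_unif[OF assms(2), of b]
      show "AE y in unif b e. fst (x, y) \<in> {a..a+d} \<and> snd (x, y) \<in> {b..b+e}"
        by (rule eventually_mono) (use x in simp)
    qed
  qed measurable
qed

lemma integrable_unif:
  fixes f :: "real \<Rightarrow> real"
  assumes "e > 0" "continuous_on {a..a+e} f" "f \<in> borel_measurable borel"
  shows "integrable (unif a e) f"
    and "integral\<^sup>L (unif a e) f = integral {a..a+e} f / e"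
proof -
  have int: "set_integrable lborel {a..a+e} f"
    using assms by (intro borel_integrable_atLeastAtMost') auto
  then have "integrable lborel (\<lambda>x. (indicator {a..a+e} x *\<^sub>R f x) / e)"
    unfolding set_integrable_def by (rule integrable_divide_zero[OF _])
  then show "integrable (unif a e) f"
    unfolding unif_def using assms by (subst integrable_density) auto
  have "integral\<^sup>L (unif a e) f = (\<integral>x. (indicator {a..a+e} x *\<^sub>R f x) / e \<partial>lborel)"
    unfolding unif_def using assms by (subst integral_density) auto
  also have "\<dots> = integral {a..a+e} f / e"
    using set_borel_integral_eq_integral(2)[OF int] by (simp add: set_lebesgue_integral_def)
  finally show "integral\<^sup>L (unif a e) f = integral {a..a+e} f / e" .
qed

section \<open>Marginals of product measures\<close>

lemma (in prob_space) distr_pair_snd: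
  assumes "sigma_finite_measure N"
  shows "distr (M \<Otimes>\<^sub>M N) N snd = N"
proof (rule measure_eqI)
  interpret N: sigma_finite_measure N by fact
  fix A assume "A \<in> sets (distr (M \<Otimes>\<^sub>M N) N snd)"
  then have A: "A \<in> sets N" by simp
  have "snd -` A \<inter> space (M \<Otimes>\<^sub>M N) = space M \<times> A"
    using sets.sets_into_space[OF A] by (auto simp: space_pair_measure)
  then show "emeasure (distr (M \<Otimes>\<^sub>M N) N snd) A = emeasure N A"
    using A by (simp add: emeasure_distr N.emeasure_pair_measure_Times emeasure_space_1)
qed auto

text \<open>The preimage of a rectangle is a cylinder over two distinct coordinates. Expectations of
  ln |x_i - x_j| over the product space thereby become double integrals.\<close>

lemma distr_PiM_pair:
  assumes "\<And>i. prob_space (M i)" "i \<in> I" "j \<in> I" "i \<noteq> j"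
  shows "distr (PiM I M) (M i \<Otimes>\<^sub>M M j) (\<lambda>x. (x i, x j)) = M i \<Otimes>\<^sub>M M j"
proof -
  interpret product_prob_space M I
    using assms(1) by (intro product_prob_spaceI)
  have [measurable]: "(\<lambda>x. (x i, x j)) \<in> measurable (PiM I M) (M i \<Otimes>\<^sub>M M j)"
    using assms by measurable
  have "M i \<Otimes>\<^sub>M M j = distr (PiM I M) (M i \<Otimes>\<^sub>M M j) (\<lambda>x. (x i, x j))"
  proof (rule pair_measure_eqI)
    fix A B assume AB: "A \<in> sets (M i)" "B \<in> sets (M j)"
    have "(\<lambda>x. (x i, x j)) -` (A \<times> B) \<inter> space (PiM I M) =
        {x \<in> space (PiM I M). \<forall>k\<in>{i, j}. x k \<in> (if k = i then A else B)}"
      using assms(4) by auto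
    then have "emeasure (distr (PiM I M) (M i \<Otimes>\<^sub>M M j) (\<lambda>x. (x i, x j))) (A \<times> B) =
        emeasure (PiM I M) {x \<in> space (PiM I M). \<forall>k\<in>{i, j}. x k \<in> (if k = i then A else B)}"
      using AB by (subst emeasure_distr) auto
    also have "\<dots> = (\<Prod>k\<in>{i, j}. emeasure (M k) (if k = i then A else B))"
      using AB assms by (intro emeasure_PiM_Collect) auto
    also have "\<dots> = emeasure (M i) A * emeasure (M j) B"
      using assms(4) by auto
    finally show "emeasure (M i) A * emeasure (M j) B =
        emeasure (distr (PiM I M) (M i \<Otimes>\<^sub>M M j) (\<lambda>x. (x i, x j))) (A \<times> B)" ..
  qed (simp_all add: sigma_finite_measures)
  then show ?thesis ..
qed

section \<open>Logarithmic energy of a short interval\<close>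

text \<open>Since \<open>sqrt\<close> is an odd function here, the single antiderivative
  \<open>2 * sqrt (z - t)\<close> works on both sides of the singularity and is continuous across
  it.\<close>

lemma integral_inverse_sqrt_dist:
  assumes "a \<le> t" "t \<le> b"
  shows "((\<lambda>z. 1 / sqrt \<bar>z - t\<bar>) has_integral (2 * sqrt (b - t) + 2 * sqrt (t - a))) {a..b}"
proof -
  have "((\<lambda>z. 1 / sqrt \<bar>z - t\<bar>) has_integral (2 * sqrt (b - t) - 2 * sqrt (a - t))) {a..b}"
  proof (rule fundamental_theorem_of_calculus_interior_strong[where S = "{t}"])
    show "continuous_on {a..b} (\<lambda>z. 2 * sqrt (z - t))"
      by (intro continuous_intros)
    fix z assume "z \<in> {a<..<b} - {t}"
    then have "(sqrt has_real_derivative ((if z > t then 1 else -1) * inverse (sqrt (z - t)) / 2)) (at (z - t))"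
      by (intro DERIV_real_sqrt_generic) auto
    then have "((\<lambda>z. sqrt (z - t)) has_real_derivative ((if z > t then 1 else -1) * inverse (sqrt (z - t)) / 2) * 1) (at z)"
      by (rule DERIV_chain2) (auto intro!: derivative_eq_intros)
    then have "((\<lambda>z. 2 * sqrt (z - t)) has_real_derivative (if z > t then 1 else -1) * inverse (sqrt (z - t))) (at z)"
      by (rule DERIV_cmult[THEN DERIV_cong]) simp
    moreover have "(if z > t then 1 else -1) * inverse (sqrt (z - t)) = 1 / sqrt \<bar>z - t\<bar>"
      using real_sqrt_minus[of "z - t"] by (auto simp: divide_inverse)
    ultimately show "((\<lambda>z. 2 * sqrt (z - t)) has_vector_derivative 1 / sqrt \<bar>z - t\<bar>) (at z)"
      by (simp add: has_real_derivative_iff_has_vector_derivative)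
  qed (use assms in auto)
  moreover have "sqrt (a - t) = - sqrt (t - a)"
    using real_sqrt_minus[of "t - a"] by simp
  ultimately show ?thesis by simp
qed

text \<open>The inequality ln u \<le> 2 sqrt u at u = e / |z - t| gives a majorant with an
  integrable singularity. Its square root part integrates to at most \<open>8 * e\<close>, and the
  density of \<open>unif a e\<close> divides this by \<open>e\<close>.\<close>

lemma nn_integral_neg_ln_dist_le:
  assumes e: "0 < e" "e \<le> 1" and t: "t \<in> {a..a+e}"
  shows "(\<integral>\<^sup>+z. ennreal (- ln \<bar>z - t\<bar>) \<partial>unif a e) \<le> ennreal (8 - ln e)"
proof -
  have pw: "- ln \<bar>z - t\<bar> \<le> - ln e + 2 * sqrt e * (1 / sqrt \<bar>z - t\<bar>)" for z
  proof (cases "z = t")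
    case False
    define u where "u = e / \<bar>z - t\<bar>"
    have u: "u > 0" using False e by (simp add: u_def)
    have "ln u = 2 * ln (sqrt u)" using u by (simp add: ln_sqrt)
    also have "\<dots> \<le> 2 * sqrt u" using ln_bound[of "sqrt u"] u by simp
    finally show ?thesis
      using False e by (simp add: u_def ln_div real_sqrt_divide)
  \<comment> \<open>At \<open>z = t\<close> both \<open>ln 0\<close> and \<open>1 / sqrt 0\<close>
    are 0, so the claim reduces to \<open>ln e\<close> being nonpositive.\<close>
  qed (use e in simp)
  let ?f = "\<lambda>z. indicator {a..a+e} z * (- ln e + 2 * sqrt e * (1 / sqrt \<bar>z - t\<bar>)) / e"
  have "ln e \<le> 0" using e by simp
  then have nonneg: "?f z \<ge> 0" for z
    using e by (intro divide_nonneg_nonneg mult_nonneg_nonneg add_nonneg_nonneg) auto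
  have "(\<integral>\<^sup>+z. ennreal (- ln \<bar>z - t\<bar>) \<partial>unif a e) =
      (\<integral>\<^sup>+z. ennreal (indicator {a..a+e} z / e) * ennreal (- ln \<bar>z - t\<bar>) \<partial>lborel)"
    unfolding unif_def by (subst nn_integral_density) auto
  also have "\<dots> \<le> (\<integral>\<^sup>+z. ennreal (?f z) \<partial>lborel)"
  proof (intro nn_integral_mono)
    fix z
    have "1 / e * (- ln \<bar>z - t\<bar>) \<le> 1 / e * (- ln e + 2 * sqrt e * (1 / sqrt \<bar>z - t\<bar>))"
      using e by (intro mult_left_mono pw) auto
    then show "ennreal (indicator {a..a+e} z / e) * ennreal (- ln \<bar>z - t\<bar>) \<le> ennreal (?f z)"
      using e by (cases "z \<in> {a..a+e}") (auto simp: ennreal_mult'[symmetric] intro!: ennreal_leI)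
  qed
  also have "\<dots> = ennreal ((- ln e * e + 2 * sqrt e * (2 * sqrt (a + e - t) + 2 * sqrt (t - a))) / e)"
  proof (rule nn_integral_has_integral_lborel[OF _ nonneg])
    have "((\<lambda>z. - ln e + 2 * sqrt e * (1 / sqrt \<bar>z - t\<bar>)) has_integral
        (- ln e * e + 2 * sqrt e * (2 * sqrt (a + e - t) + 2 * sqrt (t - a)))) {a..a+e}"
    proof (intro has_integral_add has_integral_mult_right integral_inverse_sqrt_dist)
      show "((\<lambda>z. - ln e) has_integral - ln e * e) {a..a+e}"
        using has_integral_const_real[of "- ln e" a "a + e"] e by (simp add: mult.commute)
    qed (use t in auto)
    then have "((\<lambda>z. indicator {a..a+e} z * (- ln e + 2 * sqrt e * (1 / sqrt \<bar>z - t\<bar>))) has_integral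
        (- ln e * e + 2 * sqrt e * (2 * sqrt (a + e - t) + 2 * sqrt (t - a)))) UNIV"
      by (subst (asm) has_integral_restrict_UNIV[symmetric])
         (erule back_subst[of "\<lambda>f. (f has_integral _) UNIV"], auto simp: fun_eq_iff)
    then show "(?f has_integral (- ln e * e + 2 * sqrt e * (2 * sqrt (a + e - t) + 2 * sqrt (t - a))) / e) UNIV"
      by (rule has_integral_divide)
  qed auto
  also have "\<dots> \<le> ennreal (8 - ln e)"
  proof (rule ennreal_leI)
    have "sqrt (a + e - t) \<le> sqrt e" "sqrt (t - a) \<le> sqrt e" using t by auto
    then have "2 * sqrt e * (2 * sqrt (a + e - t) + 2 * sqrt (t - a)) \<le> 2 * sqrt e * (2 * sqrt e + 2 * sqrt e)"
      using e by (intro mult_left_mono add_mono) auto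
    also have "\<dots> = 8 * e" using e by simp
    finally show "(- ln e * e + 2 * sqrt e * (2 * sqrt (a + e - t) + 2 * sqrt (t - a))) / e \<le> 8 - ln e"
      using e by (simp add: field_simps)
  qed
  finally show ?thesis .
qed

text \<open>Tonelli reduces the double integral to the preceding bound, which is uniform in
  \<open>t\<close>. As \<open>e\<close> is at most 1, the negated logarithm is nonnegative almost
  everywhere, so the finite bound also yields integrability.\<close>

lemma unif_self_energy:
  assumes e: "0 < e" "e \<le> 1"
  shows "integrable (unif a e \<Otimes>\<^sub>M unif a e) (\<lambda>(z, t). ln \<bar>z - t\<bar>)"
    and "(\<integral>(z, t). ln \<bar>z - t\<bar> \<partial>(unif a e \<Otimes>\<^sub>M unif a e)) \<ge> ln e - 8"
proof -
  interpret U: prob_space "unif a e" using e(1) by (rule prob_space_unif)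
  interpret UU: pair_prob_space "unif a e" "unif a e" ..
  let ?f = "\<lambda>(z, t). - ln \<bar>z - t\<bar> :: real"
  have "(\<integral>\<^sup>+p. ennreal (?f p) \<partial>(unif a e \<Otimes>\<^sub>M unif a e)) =
      (\<integral>\<^sup>+t. \<integral>\<^sup>+z. ennreal (- ln \<bar>z - t\<bar>) \<partial>unif a e \<partial>unif a e)"
    by (subst UU.nn_integral_snd[symmetric]) (auto simp: case_prod_unfold)
  also have "\<dots> \<le> (\<integral>\<^sup>+t. ennreal (8 - ln e) \<partial>unif a e)"
    using AE_unif[OF e(1), of a]
    by (intro nn_integral_mono_AE, eventually_elim) (rule nn_integral_neg_ln_dist_le[OF e])
  also have "\<dots> = ennreal (8 - ln e)" by (simp add: U.emeasure_space_1[simplified])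
  finally have bound: "(\<integral>\<^sup>+p. ennreal (?f p) \<partial>(unif a e \<Otimes>\<^sub>M unif a e)) \<le> ennreal (8 - ln e)" .
  have nonneg: "AE p in unif a e \<Otimes>\<^sub>M unif a e. ?f p \<ge> 0"
    using AE_unif_pair[OF e(1) e(1), of a a]
  proof eventually_elim
    case (elim p)
    then have "\<bar>fst p - snd p\<bar> \<le> 1" using e(2) by auto
    then show ?case by (cases "fst p = snd p") (auto simp: case_prod_unfold)
  qed
  have int: "integrable (unif a e \<Otimes>\<^sub>M unif a e) ?f"
    using bound nonneg by (intro integrableI_nonneg) (auto intro: le_less_trans)
  then show "integrable (unif a e \<Otimes>\<^sub>M unif a e) (\<lambda>(z, t). ln \<bar>z - t\<bar>)"
    using integrable_minus[OF int] by (simp add: case_prod_unfold)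
  have "ennreal (\<integral>p. ?f p \<partial>(unif a e \<Otimes>\<^sub>M unif a e)) \<le> ennreal (8 - ln e)"
    using bound nn_integral_eq_integral[OF int nonneg] by simp
  then have "(\<integral>p. ?f p \<partial>(unif a e \<Otimes>\<^sub>M unif a e)) \<le> 8 - ln e"
    by (rule ennreal_le_iff[THEN iffD1, rotated]) (use ln_le_zero_iff[of e] e in linarith)
  then show "(\<integral>(z, t). ln \<bar>z - t\<bar> \<partial>(unif a e \<Otimes>\<^sub>M unif a e)) \<ge> ln e - 8"
    by (simp add: case_prod_unfold)
qed

section \<open>Averages of uniform measures\<close>

text \<open>The average of the measures \<open>unif (a i) e\<close>, given by a density so that its
  product with itself also has an explicit density.\<close>

definition unif_mixture :: "nat \<Rightarrow> (nat \<Rightarrow> real) \<Rightarrow> real \<Rightarrow> real measure" where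
  "unif_mixture n a e = density lborel (\<lambda>x. ennreal ((\<Sum>i<n. indicator {a i..a i+e} x / e) / real n))"

lemma sets_unif_mixture [measurable_cong, simp]: "sets (unif_mixture n a e) = sets borel"
  and space_unif_mixture [simp]: "space (unif_mixture n a e) = UNIV"
  by (simp_all add: unif_mixture_def)

lemma emeasure_unif_mixture:
  assumes "e > 0" "n > 0" and A: "A \<in> sets borel"
  shows "emeasure (unif_mixture n a e) A = ennreal (1 / n) * (\<Sum>i<n. emeasure (unif (a i) e) A)"
proof -
  have [measurable]: "A \<in> sets borel" by (rule A)
  let ?u = "\<lambda>i x. indicator {a i..a i+e} x / e"
  have "ennreal ((\<Sum>i<n. ?u i x) / real n) = ennreal (1 / n) * (\<Sum>i<n. ennreal (?u i x))" for x
    using assms by (subst sum_ennreal) (auto simp: ennreal_mult'[symmetric])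
  then have "emeasure (unif_mixture n a e) A =
      (\<integral>\<^sup>+x. ennreal (1 / n) * (\<Sum>i<n. ennreal (?u i x) * indicator A x) \<partial>lborel)"
    unfolding unif_mixture_def
    by (subst emeasure_density) (auto simp: sum_distrib_right mult.assoc)
  also have "\<dots> = ennreal (1 / n) * (\<Sum>i<n. \<integral>\<^sup>+x. ennreal (?u i x) * indicator A x \<partial>lborel)"
    by (subst nn_integral_cmult; (subst nn_integral_sum)?; simp del: sum_mult_indicator)
  also have "\<dots> = ennreal (1 / n) * (\<Sum>i<n. emeasure (unif (a i) e) A)"
    unfolding unif_def by (intro arg_cong2[where f = "(*)"] refl sum.cong) (subst emeasure_density, auto)
  finally show ?thesis .
qed

lemma prob_space_unif_mixture:
  assumes "e > 0" "n > 0"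
  shows "prob_space (unif_mixture n a e)"
proof (rule prob_spaceI)
  have "emeasure (unif (a i) e) UNIV = 1" for i
    using prob_space.emeasure_space_1[OF prob_space_unif[OF assms(1), of "a i"]] by simp
  moreover have "ennreal (1 / n) * of_nat n = 1"
    unfolding ennreal_of_nat_eq_real_of_nat using assms(2)
    by (subst ennreal_mult'[symmetric]) auto
  ultimately show "emeasure (unif_mixture n a e) (space (unif_mixture n a e)) = 1"
    using assms by (simp add: emeasure_unif_mixture)
qed

lemma unif_mixture_in_unit_measures_on:
  assumes "e > 0" "n > 0" and "\<And>i. i < n \<Longrightarrow> l \<le> a i \<and> a i + e \<le> r"
  shows "unif_mixture n a e \<in> unit_measures_on l r"
proof -
  have "emeasure (unif (a i) e) (- {l..r}) = 0" if "i < n" for i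
  proof -
    have "AE x in unif (a i) e. \<not> x \<in> - {l..r}"
      using AE_unif[OF assms(1), of "a i"] by (rule eventually_mono) (use assms(3)[OF that] in auto)
    then show ?thesis using emeasure_eq_0_AE[of "\<lambda>x. x \<in> - {l..r}" "unif (a i) e"]
      by (simp only: space_unif UNIV_I simp_thms Collect_mem_eq)
  qed
  then show ?thesis
    using prob_space.emeasure_space_1[OF prob_space_unif_mixture[OF assms(1,2), of a]] assms
    by (simp add: unit_measures_on_def emeasure_unif_mixture)
qed

lemma pair_density_lborel:
  fixes f g :: "real \<Rightarrow> real"
  assumes [measurable]: "f \<in> borel_measurable borel" "g \<in> borel_measurable borel"
    and "\<And>x. f x \<ge> 0" "\<And>x. g x \<ge> 0" "prob_space (density lborel g)"
  shows "density lborel f \<Otimes>\<^sub>M density lborel g =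
         density (lborel \<Otimes>\<^sub>M lborel) (\<lambda>p. ennreal (f (fst p) * g (snd p)))"
proof -
  interpret prob_space "density lborel g" by fact
  show ?thesis
    by (subst pair_measure_density)
       (use assms in \<open>auto simp: case_prod_unfold ennreal_mult sigma_finite_measure_axioms lborel.sigma_finite_measure_axioms\<close>)
qed

text \<open>The density of the product of the average with itself is the average of the densities of
  all n^2 products, including the terms with \<open>i = j\<close>.\<close>

lemma integral_unif_mixture_pair:
  fixes f :: "real \<times> real \<Rightarrow> real"
  assumes "e > 0" "n > 0" and [measurable]: "f \<in> borel_measurable borel"
    and int: "\<And>i j. i < n \<Longrightarrow> j < n \<Longrightarrow> integrable (unif (a i) e \<Otimes>\<^sub>M unif (a j) e) f"
  shows "integrable (unif_mixture n a e \<Otimes>\<^sub>M unif_mixture n a e) f"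
    and "integral\<^sup>L (unif_mixture n a e \<Otimes>\<^sub>M unif_mixture n a e) f =
         (\<Sum>i<n. \<Sum>j<n. integral\<^sup>L (unif (a i) e \<Otimes>\<^sub>M unif (a j) e) f) / (real n)\<^sup>2"
proof -
  define u where "u = (\<lambda>i x. indicator {a i..a i+e} x / e)"
  define \<rho> where "\<rho> = (\<lambda>x. (\<Sum>i<n. u i x) / real n)"
  have u0: "u i x \<ge> 0" for i x using assms by (simp add: u_def)
  have um [measurable]: "u i \<in> borel_measurable borel" for i by (simp add: u_def)
  have \<rho>0: "\<rho> x \<ge> 0" for x using u0 by (auto simp: \<rho>_def intro!: divide_nonneg_nonneg sum_nonneg)
  have \<rho>m [measurable]: "\<rho> \<in> borel_measurable borel" by (simp add: \<rho>_def)
  have fm [measurable]: "f \<in> borel_measurable (lborel \<Otimes>\<^sub>M lborel)"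
    using assms(3) measurable_cong_sets[OF sets_pair_measure_cong[OF sets_lborel sets_lborel] refl]
    by (metis borel_prod)
  have unif: "unif (a i) e = density lborel (u i)" for i by (simp add: unif_def u_def)
  have mix: "unif_mixture n a e = density lborel \<rho>" by (simp add: unif_mixture_def \<rho>_def u_def)
  have pu: "unif (a i) e \<Otimes>\<^sub>M unif (a j) e = density (lborel \<Otimes>\<^sub>M lborel) (\<lambda>p. ennreal (u i (fst p) * u j (snd p)))" for i j
    unfolding unif using prob_space_unif[OF assms(1), of "a j"] u0
    by (intro pair_density_lborel) (auto simp: unif)
  have pm: "unif_mixture n a e \<Otimes>\<^sub>M unif_mixture n a e = density (lborel \<Otimes>\<^sub>M lborel) (\<lambda>p. ennreal (\<rho> (fst p) * \<rho> (snd p)))"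
    unfolding mix using prob_space_unif_mixture[OF assms(1,2), of a] \<rho>0
    by (intro pair_density_lborel) (auto simp: mix)
  have int': "integrable (lborel \<Otimes>\<^sub>M lborel) (\<lambda>p. (u i (fst p) * u j (snd p)) *\<^sub>R f p)"
    if "i < n" "j < n" for i j
    using int[OF that] unfolding pu using u0 by (subst (asm) integrable_density) auto
  define g where "g = (\<lambda>p. \<Sum>i<n. \<Sum>j<n. (u i (fst p) * u j (snd p)) *\<^sub>R f p)"
  have \<rho>: "(\<rho> (fst p) * \<rho> (snd p)) *\<^sub>R f p = g p / (real n)\<^sup>2" for p
  proof -
    have "\<rho> x * \<rho> y = (\<Sum>i<n. \<Sum>j<n. u i x * u j y) / (real n)\<^sup>2" for x y
      by (simp add: \<rho>_def sum_product power2_eq_square)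
    then show ?thesis by (simp add: g_def sum_distrib_right)
  qed
  have ig: "integrable (lborel \<Otimes>\<^sub>M lborel) g"
    unfolding g_def by (intro Bochner_Integration.integrable_sum int') auto
  have "integral\<^sup>L (lborel \<Otimes>\<^sub>M lborel) g =
      (\<Sum>i<n. \<integral>p. (\<Sum>j<n. (u i (fst p) * u j (snd p)) *\<^sub>R f p) \<partial>(lborel \<Otimes>\<^sub>M lborel))"
    unfolding g_def by (intro Bochner_Integration.integral_sum Bochner_Integration.integrable_sum int') auto
  also have "\<dots> = (\<Sum>i<n. \<Sum>j<n. \<integral>p. (u i (fst p) * u j (snd p)) *\<^sub>R f p \<partial>(lborel \<Otimes>\<^sub>M lborel))"
    by (intro sum.cong refl Bochner_Integration.integral_sum int') auto
  also have "\<dots> = (\<Sum>i<n. \<Sum>j<n. integral\<^sup>L (unif (a i) e \<Otimes>\<^sub>M unif (a j) e) f)"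
    unfolding pu using u0 by (intro sum.cong refl) (subst integral_density, auto)
  finally have g: "integral\<^sup>L (lborel \<Otimes>\<^sub>M lborel) g = (\<Sum>i<n. \<Sum>j<n. integral\<^sup>L (unif (a i) e \<Otimes>\<^sub>M unif (a j) e) f)" .
  have "integrable (lborel \<Otimes>\<^sub>M lborel) (\<lambda>p. g p / (real n)\<^sup>2)"
    using ig by (rule integrable_divide_zero[OF _])
  then show "integrable (unif_mixture n a e \<Otimes>\<^sub>M unif_mixture n a e) f"
    unfolding pm using \<rho>0 by (subst integrable_density) (simp_all only: \<rho>, auto)
  have "integral\<^sup>L (unif_mixture n a e \<Otimes>\<^sub>M unif_mixture n a e) f =
     (\<integral>p. (\<rho> (fst p) * \<rho> (snd p)) *\<^sub>R f p \<partial>(lborel \<Otimes>\<^sub>M lborel))"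
    unfolding pm using \<rho>0 by (subst integral_density) auto
  also have "\<dots> = (\<Sum>i<n. \<Sum>j<n. integral\<^sup>L (unif (a i) e \<Otimes>\<^sub>M unif (a j) e) f) / (real n)\<^sup>2"
    unfolding \<rho> g[symmetric] by simp
  finally show "integral\<^sup>L (unif_mixture n a e \<Otimes>\<^sub>M unif_mixture n a e) f =
         (\<Sum>i<n. \<Sum>j<n. integral\<^sup>L (unif (a i) e \<Otimes>\<^sub>M unif (a j) e) f) / (real n)\<^sup>2" .
qed

text \<open>For an integrable function both parts are finite, so no difference of infinities arises;
  the infinite values of the kernel on a null set, such as the diagonal, do not affect the
  integral.\<close>

lemma ereal_integral_eq_lebesgue_integral:
  assumes "integrable M f" "AE x in M. g x = ereal (f x)"
  shows "ereal_integral M g = ereal (integral\<^sup>L M f)"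
proof -
  have "(\<integral>\<^sup>+x. e2ennreal (g x) \<partial>M) = (\<integral>\<^sup>+x. ennreal (f x) \<partial>M)"
    using assms(2) by (intro nn_integral_cong_AE) (auto elim!: eventually_mono)
  moreover have "(\<integral>\<^sup>+x. e2ennreal (- g x) \<partial>M) = (\<integral>\<^sup>+x. ennreal (- f x) \<partial>M)"
    using assms(2) by (intro nn_integral_cong_AE) (auto elim!: eventually_mono)
  moreover obtain r q where "0 \<le> r" "0 \<le> q" "(\<integral>\<^sup>+x. ennreal (f x) \<partial>M) = ennreal r"
    "(\<integral>\<^sup>+x. ennreal (- f x) \<partial>M) = ennreal q" "integral\<^sup>L M f = r - q"
    using assms(1) by (rule integrableE)
  ultimately show ?thesis
    by (simp add: ereal_integral_def)
qed

section \<open>Weighted energy of smeared points\<close>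

text \<open>The bound \<open>c\<close> is averaged over independent uniform points \<open>x\<^sub>i\<close>: this gives the energy of the
  mixture except for the diagonal terms, each of which is at most \<open>8 - ln e\<close>.\<close>

lemma weighted_V_le_smeared_energy:
  fixes a :: "nat \<Rightarrow> real" and w :: "real \<Rightarrow> real"
  assumes n: "n > 0" and e: "0 < e" "e \<le> 1"
    and a: "\<And>i. i < n \<Longrightarrow> 0 \<le> a i \<and> a i + e \<le> 1"
    and w [measurable]: "w \<in> borel_measurable borel"
    and wpos: "\<And>i x. i < n \<Longrightarrow> x \<in> {a i..a i+e} \<Longrightarrow> w x > 0 \<and> \<bar>ln (w x)\<bar> \<le> B"
    and sep: "\<delta> > 0" "\<And>i j x y. i < n \<Longrightarrow> j < n \<Longrightarrow> i \<noteq> j \<Longrightarrow> x \<in> {a i..a i+e} \<Longrightarrow> y \<in> {a j..a j+e} \<Longrightarrow> \<bar>x - y\<bar> \<ge> \<delta>"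
    and c: "\<And>x. (\<And>i. i < n \<Longrightarrow> x i \<in> {a i..a i+e}) \<Longrightarrow>
        c \<le> (\<Sum>i<n. \<Sum>j\<in>{..<n} - {i}. ln \<bar>x i - x j\<bar>) + 2 * real n * (\<Sum>i<n. ln (w (x i)))"
  shows "weighted_V 0 1 w \<le> ereal ((real n * (8 - ln e) - c) / (real n)\<^sup>2)"
proof -
  let ?\<nu> = "\<lambda>i. unif (a i) e"
  let ?\<mu> = "unif_mixture n a e"
  let ?L = "\<lambda>p :: real \<times> real. ln \<bar>fst p - snd p\<bar>"
  let ?K = "\<lambda>p. - ?L p - ln (w (fst p)) - ln (w (snd p))"
  define A where "A i j = integral\<^sup>L (?\<nu> i \<Otimes>\<^sub>M ?\<nu> j) ?L" for i j
  define W where "W i = integral\<^sup>L (?\<nu> i) (\<lambda>x. ln (w x))" for i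
  have prob: "prob_space (?\<nu> i)" for i using e(1) by (rule prob_space_unif)
  interpret P: product_prob_space ?\<nu> "{..<n}" by (rule product_prob_spaceI) (rule prob)
  have fst: "distr (?\<nu> i \<Otimes>\<^sub>M ?\<nu> j) (?\<nu> i) fst = ?\<nu> i" for i j
    using prob by (rule prob_space.distr_pair_fst)
  have snd: "distr (?\<nu> i \<Otimes>\<^sub>M ?\<nu> j) (?\<nu> j) snd = ?\<nu> j" for i j
    using prob[of i] P.sigma_finite_measures by (rule prob_space.distr_pair_snd)
  have intW: "integrable (?\<nu> i) (\<lambda>x. ln (w x))" if "i < n" for i
  proof (rule finite_measure.integrable_const_bound[OF prob_space.finite_measure[OF prob], where B = B])
    show "AE x in ?\<nu> i. norm (ln (w x)) \<le> B"
      using AE_unif[OF e(1), of "a i"] by (rule eventually_mono) (use wpos[OF that] in simp)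
  qed measurable
  have intWfst: "integrable (?\<nu> i \<Otimes>\<^sub>M ?\<nu> j) (\<lambda>p. ln (w (fst p)))"
    and Wfst: "(\<integral>p. ln (w (fst p)) \<partial>(?\<nu> i \<Otimes>\<^sub>M ?\<nu> j)) = W i" if "i < n" for i j
    using intW[OF that] unfolding W_def
    by (subst (asm) fst[of i j, symmetric], subst (asm) integrable_distr_eq; simp)
       (subst (2) fst[of i j, symmetric], subst integral_distr; simp)
  have intWsnd: "integrable (?\<nu> i \<Otimes>\<^sub>M ?\<nu> j) (\<lambda>p. ln (w (snd p)))"
    and Wsnd: "(\<integral>p. ln (w (snd p)) \<partial>(?\<nu> i \<Otimes>\<^sub>M ?\<nu> j)) = W j" if "j < n" for i j
    using intW[OF that] unfolding W_def
    by (subst (asm) snd[of i j, symmetric], subst (asm) integrable_distr_eq; simp)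
       (subst (2) snd[of i j, symmetric], subst integral_distr; simp)
  have intL: "integrable (?\<nu> i \<Otimes>\<^sub>M ?\<nu> j) ?L" if ij: "i < n" "j < n" for i j
  proof (cases "i = j")
    case True
    then show ?thesis using unif_self_energy(1)[OF e, of "a i"] by (simp add: case_prod_unfold)
  next
    \<comment> \<open>For distinct indices the distance lies between \<delta> and 1, so its
      logarithm is bounded.\<close>
    case False
    interpret Q: pair_prob_space "?\<nu> i" "?\<nu> j"
      by (intro pair_prob_space.intro pair_sigma_finite.intro prob P.sigma_finite_measures)
    show ?thesis
    proof (rule Q.P.integrable_const_bound[where B = "- ln \<delta>"])
      show "AE p in ?\<nu> i \<Otimes>\<^sub>M ?\<nu> j. norm (?L p) \<le> - ln \<delta>"
        using AE_unif_pair[OF e(1) e(1), of "a i" "a j"]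
      proof eventually_elim
        case (elim p)
        then have "\<delta> \<le> \<bar>fst p - snd p\<bar>" using sep(2)[OF ij False] by auto
        moreover have "\<bar>fst p - snd p\<bar> \<le> 1" using elim a[OF ij(1)] a[OF ij(2)] by auto
        ultimately show ?case using sep(1) by simp
      qed
    qed measurable
  qed
  have "c \<le> (\<Sum>i<n. \<Sum>j\<in>{..<n} - {i}. A i j) + 2 * real n * (\<Sum>i<n. W i)"
  proof -
    let ?P = "PiM {..<n} ?\<nu>"
    let ?S = "\<lambda>x. (\<Sum>i<n. \<Sum>j\<in>{..<n} - {i}. ln \<bar>x i - x j\<bar>) + 2 * real n * (\<Sum>i<n. ln (w (x i)))"
    have pair: "integrable ?P (\<lambda>x. ln \<bar>x i - x j\<bar>)" "(\<integral>x. ln \<bar>x i - x j\<bar> \<partial>?P) = A i j"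
      if ij: "i < n" "j \<in> {..<n} - {i}" for i j
    proof -
      have d: "distr ?P (?\<nu> i \<Otimes>\<^sub>M ?\<nu> j) (\<lambda>x. (x i, x j)) = ?\<nu> i \<Otimes>\<^sub>M ?\<nu> j"
        using ij by (intro distr_PiM_pair prob) auto
      have m [measurable]: "(\<lambda>x. (x i, x j)) \<in> measurable ?P (?\<nu> i \<Otimes>\<^sub>M ?\<nu> j)"
        using ij by (intro measurable_Pair measurable_component_singleton) auto
      have "integrable (?\<nu> i \<Otimes>\<^sub>M ?\<nu> j) ?L" using ij by (intro intL) auto
      then show "integrable ?P (\<lambda>x. ln \<bar>x i - x j\<bar>)"
        by (subst (asm) d[symmetric], subst (asm) integrable_distr_eq) auto
      show "(\<integral>x. ln \<bar>x i - x j\<bar> \<partial>?P) = A i j"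
        unfolding A_def by (subst d[symmetric], subst integral_distr) auto
    qed
    have single: "integrable ?P (\<lambda>x. ln (w (x i)))" "(\<integral>x. ln (w (x i)) \<partial>?P) = W i" if i: "i < n" for i
    proof -
      have d: "distr ?P (?\<nu> i) (\<lambda>x. x i) = ?\<nu> i" using i by (intro P.PiM_component) auto
      have m [measurable]: "(\<lambda>x. x i) \<in> measurable ?P (?\<nu> i)"
        using i by (intro measurable_component_singleton) auto
      show "integrable ?P (\<lambda>x. ln (w (x i)))"
        using intW[OF i] by (subst (asm) d[symmetric], subst (asm) integrable_distr_eq) auto
      show "(\<integral>x. ln (w (x i)) \<partial>?P) = W i"
        unfolding W_def by (subst d[symmetric], subst integral_distr) auto
    qed
    have ae: "AE x in ?P. \<forall>i\<in>{..<n}. x i \<in> {a i..a i+e}"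
      using AE_unif[OF e(1)] by (intro AE_finite_allI AE_PiM_component prob) auto
    have intS: "integrable ?P ?S"
      by (intro Bochner_Integration.integrable_add Bochner_Integration.integrable_sum
          integrable_mult_right pair single) auto
    have "c = (\<integral>x. c \<partial>?P)" by (simp add: P.P.prob_space)
    also have "\<dots> \<le> integral\<^sup>L ?P ?S"
    proof (rule integral_mono_AE[OF _ intS])
      from ae show "AE x in ?P. c \<le> ?S x" by (rule eventually_mono) (rule c, simp)
    qed simp
    also have "\<dots> = (\<Sum>i<n. \<Sum>j\<in>{..<n} - {i}. A i j) + 2 * real n * (\<Sum>i<n. W i)"
    proof -
      have i1: "integrable ?P (\<lambda>x. \<Sum>j\<in>{..<n} - {i}. ln \<bar>x i - x j\<bar>)" if "i < n" for i
        using that by (intro Bochner_Integration.integrable_sum pair) auto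
      have i2: "integrable ?P (\<lambda>x. \<Sum>i<n. \<Sum>j\<in>{..<n} - {i}. ln \<bar>x i - x j\<bar>)"
        by (intro Bochner_Integration.integrable_sum i1) auto
      have i3: "integrable ?P (\<lambda>x. \<Sum>i<n. ln (w (x i)))"
        by (intro Bochner_Integration.integrable_sum single) auto
      have e1: "(\<integral>x. (\<Sum>j\<in>{..<n} - {i}. ln \<bar>x i - x j\<bar>) \<partial>?P) = (\<Sum>j\<in>{..<n} - {i}. A i j)" if "i < n" for i
        using that pair by (subst Bochner_Integration.integral_sum) auto
      have e2: "(\<integral>x. (\<Sum>i<n. \<Sum>j\<in>{..<n} - {i}. ln \<bar>x i - x j\<bar>) \<partial>?P) = (\<Sum>i<n. \<Sum>j\<in>{..<n} - {i}. A i j)"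
        using i1 e1 by (subst Bochner_Integration.integral_sum) auto
      have e3: "(\<integral>x. (\<Sum>i<n. ln (w (x i))) \<partial>?P) = (\<Sum>i<n. W i)"
        using single by (subst Bochner_Integration.integral_sum) auto
      show ?thesis
        using i2 i3 by (subst Bochner_Integration.integral_add) (simp_all add: e2 e3)
    qed
    finally show ?thesis .
  qed
  moreover have "real n * (ln e - 8) \<le> (\<Sum>i<n. A i i)"
    using unif_self_energy(2)[OF e] sum_bounded_below[of "{..<n}" "ln e - 8" "\<lambda>i. A i i"]
    by (simp add: A_def case_prod_unfold)
  moreover have "(\<Sum>i<n. \<Sum>j<n. A i j) = (\<Sum>i<n. \<Sum>j\<in>{..<n} - {i}. A i j) + (\<Sum>i<n. A i i)"
    unfolding sum.distrib[symmetric]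
    by (intro sum.cong refl) (simp add: sum.remove[of "{..<n}"])
  ultimately have "- (\<Sum>i<n. \<Sum>j<n. A i j) - 2 * real n * (\<Sum>i<n. W i) \<le> real n * (8 - ln e) - c"
    by (simp add: algebra_simps)
  moreover have "(\<Sum>i<n. \<Sum>j<n. integral\<^sup>L (?\<nu> i \<Otimes>\<^sub>M ?\<nu> j) ?K) = - (\<Sum>i<n. \<Sum>j<n. A i j) - 2 * real n * (\<Sum>i<n. W i)"
  proof -
    have "(\<Sum>i<n. \<Sum>j<n. integral\<^sup>L (?\<nu> i \<Otimes>\<^sub>M ?\<nu> j) ?K) = (\<Sum>i<n. \<Sum>j<n. - A i j - W i - W j)"
      using intL intWfst intWsnd by (intro sum.cong refl) (simp add: A_def Wfst Wsnd)
    then show ?thesis by (simp add: sum_subtractf sum_negf sum_distrib_left mult.assoc)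
  qed
  ultimately have K: "(\<Sum>i<n. \<Sum>j<n. integral\<^sup>L (?\<nu> i \<Otimes>\<^sub>M ?\<nu> j) ?K) / (real n)\<^sup>2 \<le> (real n * (8 - ln e) - c) / (real n)\<^sup>2"
    by (intro divide_right_mono) auto
  have Kint: "integrable (?\<nu> i \<Otimes>\<^sub>M ?\<nu> j) ?K" if "i < n" "j < n" for i j
    using that intL intWfst intWsnd by auto
  have Km: "?K \<in> borel_measurable borel"
    unfolding borel_prod[symmetric] by measurable
  note mix = integral_unif_mixture_pair[OF e(1) n Km, of a, OF Kint]
  interpret M: prob_space ?\<mu> using e(1) n by (rule prob_space_unif_mixture)
  interpret MM: pair_prob_space ?\<mu> ?\<mu> ..
  have supp: "AE x in ?\<mu>. w x > 0"
    unfolding unif_mixture_def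
  proof (subst AE_density)
    have "w x > 0" if "0 < ennreal ((\<Sum>i<n. indicator {a i..a i+e} x / e) / real n)" for x
    proof (rule ccontr)
      assume "\<not> w x > 0"
      then have "indicator {a i..a i+e} x / e = 0" if "i < n" for i
        using wpos[OF that, of x] by (auto split: split_indicator)
      then have "(\<Sum>i<n. indicator {a i..a i+e} x / e) = 0" by (intro sum.neutral) auto
      with that show False by simp
    qed
    then show "AE x in lborel. 0 < ennreal ((\<Sum>i<n. indicator {a i..a i+e} x / e) / real n) \<longrightarrow> w x > 0"
      by (intro AE_I2) blast
  qed measurable
  have nodiag: "AE y in ?\<mu>. y \<noteq> x" for x
    unfolding unif_mixture_def
    using AE_lborel_singleton[of x] by (subst AE_density) (auto elim!: eventually_mono)
  \<comment> \<open>Outside this null set the argument of the logarithm in \<open>log_kernel\<close>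
    is positive, so the kernel is finite and splits into the sum \<open>?K\<close>.\<close>
  have "AE p in ?\<mu> \<Otimes>\<^sub>M ?\<mu>. w (fst p) > 0 \<and> w (snd p) > 0 \<and> snd p \<noteq> fst p"
  proof (rule MM.AE_pair_measure)
    from supp show "AE x in ?\<mu>. AE y in ?\<mu>. w (fst (x, y)) > 0 \<and> w (snd (x, y)) > 0 \<and> snd (x, y) \<noteq> fst (x, y)"
    proof (rule eventually_mono)
      fix x assume x: "w x > 0"
      from supp nodiag[of x] show "AE y in ?\<mu>. w (fst (x, y)) > 0 \<and> w (snd (x, y)) > 0 \<and> snd (x, y) \<noteq> fst (x, y)"
        by eventually_elim (use x in simp)
    qed
  qed measurable
  then have "AE p in ?\<mu> \<Otimes>\<^sub>M ?\<mu>. log_kernel w p = ereal (?K p)"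
    by (rule eventually_mono) (auto simp: log_kernel_def Let_def ln_mult)
  with mix(1) have "weighted_energy w ?\<mu> = ereal (integral\<^sup>L (?\<mu> \<Otimes>\<^sub>M ?\<mu>) ?K)"
    unfolding weighted_energy_def by (intro ereal_integral_eq_lebesgue_integral)
  moreover have "weighted_V 0 1 w \<le> weighted_energy w ?\<mu>"
    unfolding weighted_V_def
    by (intro INF_lower unif_mixture_in_unit_measures_on e n) (use a in auto)
  ultimately show ?thesis using mix(2) K by (auto intro: order.trans)
qed

section \<open>Maximum and mean square on the unit cube\<close>

text \<open>Expanding both Vandermonde factors splits the integral into signed products of moments
  of \<open>P\<close> on the unit interval. The permutation of the first factor decides which least
  common multiple clears the denominator of which moment.\<close>

lemma selberg_integral:
  fixes P :: "int poly" and n :: nat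
  assumes D: "degree P \<le> D"
  defines "I \<equiv> (\<lambda>x. (vandermonde n x)\<^sup>2 * (\<Prod>k<n. poly (map_poly real_of_int P) (x k)))"
  shows "integrable (PiM {..<n} (\<lambda>_. unif 0 1)) I"
    and "real (\<Prod>j<n. psi_lcm (n + D + j)) * integral\<^sup>L (PiM {..<n} (\<lambda>_. unif 0 1)) I \<in> \<int>"
proof -
  let ?P = "poly (map_poly real_of_int P)" and ?M = "PiM {..<n} (\<lambda>_. unif 0 1)"
  let ?S = "{p. p permutes {..<n}}"
  define f where "f \<sigma> \<tau> k x = x ^ (\<sigma> k + \<tau> k) * ?P x" for \<sigma> \<tau> :: "nat \<Rightarrow> nat" and k x
  interpret product_prob_space "\<lambda>_. unif 0 1" "{..<n}"
    by (intro product_prob_spaceI prob_space_unif) simp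
  have fin: "finite ?S" by (rule finite_permutations) auto
  have I: "I x = (\<Sum>\<sigma>\<in>?S. \<Sum>\<tau>\<in>?S. of_int (sign \<sigma> * sign \<tau>) * (\<Prod>k<n. f \<sigma> \<tau> k (x k)))" for x
  proof -
    have "(vandermonde n x)\<^sup>2 = (\<Sum>\<sigma>\<in>?S. \<Sum>\<tau>\<in>?S. of_int (sign \<sigma> * sign \<tau>) * (\<Prod>k<n. x k ^ (\<sigma> k + \<tau> k)))"
      unfolding vandermonde_leibniz leibniz_vandermonde_def power2_eq_square sum_product
      by (intro sum.cong refl) (simp add: power_add prod.distrib)
    then show ?thesis
      unfolding I_def f_def by (simp add: sum_distrib_right prod.distrib mult.assoc)
  qed
  have f_int: "integrable (unif 0 1) (f \<sigma> \<tau> k)" "integral\<^sup>L (unif 0 1) (f \<sigma> \<tau> k) = integral {0..1} (f \<sigma> \<tau> k)" for \<sigma> \<tau> k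
  proof -
    have c: "continuous_on UNIV (f \<sigma> \<tau> k)" unfolding f_def by (intro continuous_intros)
    have "continuous_on {0..0+1} (f \<sigma> \<tau> k)" using c by (rule continuous_on_subset) simp
    moreover have "f \<sigma> \<tau> k \<in> borel_measurable borel" using c by (rule borel_measurable_continuous_onI)
    ultimately have *: "integrable (unif 0 1) (f \<sigma> \<tau> k)"
      "integral\<^sup>L (unif 0 1) (f \<sigma> \<tau> k) = integral {0..0+1} (f \<sigma> \<tau> k) / 1"
      by (rule integrable_unif[OF zero_less_one])+
    show "integrable (unif 0 1) (f \<sigma> \<tau> k)" by (rule *)
    show "integral\<^sup>L (unif 0 1) (f \<sigma> \<tau> k) = integral {0..1} (f \<sigma> \<tau> k)" using *(2) by simp
  qed
  have prod_int: "integrable ?M (\<lambda>x. \<Prod>k<n. f \<sigma> \<tau> k (x k))"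
    "(\<integral>x. (\<Prod>k<n. f \<sigma> \<tau> k (x k)) \<partial>?M) = (\<Prod>k<n. integral {0..1} (f \<sigma> \<tau> k))" for \<sigma> \<tau>
    using product_integrable_prod[of "{..<n}" "f \<sigma> \<tau>"] product_integral_prod[of "{..<n}" "f \<sigma> \<tau>"] f_int
    by simp_all
  have int1: "integrable ?M (\<lambda>x. \<Sum>\<tau>\<in>?S. of_int (sign \<sigma> * sign \<tau>) * (\<Prod>k<n. f \<sigma> \<tau> k (x k)))" for \<sigma>
    by (intro Bochner_Integration.integrable_sum integrable_mult_right prod_int)
  show "integrable ?M I"
    unfolding I by (intro Bochner_Integration.integrable_sum int1)
  have "integral\<^sup>L ?M I = (\<Sum>\<sigma>\<in>?S. \<Sum>\<tau>\<in>?S. of_int (sign \<sigma> * sign \<tau>) * (\<Prod>k<n. integral {0..1} (f \<sigma> \<tau> k)))"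
    unfolding I
    by (subst Bochner_Integration.integral_sum[OF int1], intro sum.cong refl,
        subst Bochner_Integration.integral_sum)
       (intro integrable_mult_right prod_int, simp add: prod_int)
  then have "real (\<Prod>j<n. psi_lcm (n + D + j)) * integral\<^sup>L ?M I =
      (\<Sum>\<sigma>\<in>?S. \<Sum>\<tau>\<in>?S. of_int (sign \<sigma> * sign \<tau>) *
         (real (\<Prod>j<n. psi_lcm (n + D + j)) * (\<Prod>k<n. integral {0..1} (f \<sigma> \<tau> k))))"
    by (simp add: sum_distrib_left mult_ac)
  also have "\<dots> \<in> \<int>"
  proof (intro Ints_sum Ints_mult[OF Ints_of_int])
    fix \<sigma> \<tau> assume \<sigma>: "\<sigma> \<in> ?S" and \<tau>: "\<tau> \<in> ?S"
    \<comment> \<open>Reassigning the multiples along \<sigma> gives coordinate \<open>k\<close> the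
      index \<open>n + D + \<sigma> k\<close>, which exceeds
      \<open>\<sigma> k + \<tau> k + D\<close> because \<open>\<tau> k < n\<close>.\<close>
    have "(\<Prod>j<n. psi_lcm (n + D + j)) = (\<Prod>k<n. psi_lcm (n + D + \<sigma> k))"
      using \<sigma> by (intro prod.reindex_bij_betw[symmetric] permutes_imp_bij) auto
    then have "real (\<Prod>j<n. psi_lcm (n + D + j)) * (\<Prod>k<n. integral {0..1} (f \<sigma> \<tau> k)) =
        (\<Prod>k<n. real (psi_lcm (n + D + \<sigma> k)) * integral {0..1} (f \<sigma> \<tau> k))"
      by (simp add: prod.distrib)
    also have "\<dots> \<in> \<int>"
    proof (intro Ints_prod)
      fix k assume "k \<in> {..<n}"
      then have "\<tau> k < n" using \<tau> permutes_in_image[of \<tau> "{..<n}" k] by auto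
      then show "real (psi_lcm (n + D + \<sigma> k)) * integral {0..1} (f \<sigma> \<tau> k) \<in> \<int>"
        unfolding f_def by (intro psi_lcm_times_moment_Ints[OF D]) simp
    qed
    finally show "real (\<Prod>j<n. psi_lcm (n + D + j)) * (\<Prod>k<n. integral {0..1} (f \<sigma> \<tau> k)) \<in> \<int>" .
  qed
  finally show "real (\<Prod>j<n. psi_lcm (n + D + j)) * integral\<^sup>L ?M I \<in> \<int>" .
qed

section \<open>The extremal product G on the unit cube\<close>

definition vandermonde_weight :: "nat \<Rightarrow> 'a::comm_ring_1 poly \<Rightarrow> (nat \<Rightarrow> 'a) \<Rightarrow> 'a" where
  "vandermonde_weight n R x = vandermonde n x * (\<Prod>k<n. poly R (x k))"

lemma vandermonde_weight_cong:
  assumes "\<And>k. k < n \<Longrightarrow> x k = y k"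
  shows "vandermonde_weight n R x = vandermonde_weight n R y"
  unfolding vandermonde_weight_def vandermonde_def using assms
  by (intro arg_cong2[where f = "(*)"] prod.cong refl arg_cong2[where f = "(-)"] arg_cong[where f = "poly R"]) auto

text \<open>Substitute the polynomial variable for \<open>x i\<close> and constants for the other
  coordinates. In each Leibniz term the variable has exponent \<open>q i\<close>, at most
  \<open>n - 1\<close>, and it enters only one factor of the product of values of
  \<open>R\<close>.\<close>

lemma vandermonde_weight_in_one_variable:
  fixes R :: "'a::{idom, ring_char_0} poly"
  assumes "i < n"
  obtains p where "degree p \<le> n - 1 + degree R" "\<And>t. poly p t = vandermonde_weight n R (x(i := t))"
proof
  define c where "c k = (if k = i then [:0, 1:] else [:x k:])" for k
  define p where "p = vandermonde n c * (\<Prod>k<n. pcompose R (c k))"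
  have c: "degree (c k) = (if k = i then 1 else 0)" for k
    by (simp add: c_def)
  have "degree (vandermonde n c) \<le> n - 1"
    unfolding vandermonde_leibniz leibniz_vandermonde_def
  proof (intro degree_sum_le)
    fix q assume q: "q \<in> {q. q permutes {..<n}}"
    have "degree (\<Prod>k<n. c k ^ q k) \<le> (\<Sum>k<n. degree (c k ^ q k))"
      by (rule degree_prod_sum_le[unfolded o_def]) simp
    also have "\<dots> \<le> (\<Sum>k<n. if k = i then q k else 0)"
      by (intro sum_mono order.trans[OF degree_power_le]) (simp add: c)
    also have "\<dots> \<le> n - 1"
      using assms q permutes_in_image[of q "{..<n}" i] by auto
    finally have "degree (\<Prod>k<n. c k ^ q k) \<le> n - 1" .
    then show "degree (of_int (sign q) * (\<Prod>k<n. c k ^ q k)) \<le> n - 1"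
      by (intro order.trans[OF degree_mult_le]) simp
  qed (auto intro: finite_permutations)
  moreover have "degree (\<Prod>k<n. pcompose R (c k)) \<le> degree R"
  proof -
    have "degree (\<Prod>k<n. pcompose R (c k)) \<le> (\<Sum>k<n. degree (pcompose R (c k)))"
      by (rule degree_prod_sum_le[unfolded o_def]) simp
    also have "\<dots> = (\<Sum>k<n. if k = i then degree R else 0)"
      by (intro sum.cong refl) (simp add: degree_pcompose c)
    also have "\<dots> \<le> degree R" by simp
    finally show ?thesis .
  qed
  ultimately show "degree p \<le> n - 1 + degree R"
    unfolding p_def by (intro order.trans[OF degree_mult_le] add_mono)
  fix t
  have ct: "poly (c k) t = (x(i := t)) k" for k by (simp add: c_def)
  show "poly p t = vandermonde_weight n R (x(i := t))"
    unfolding p_def vandermonde_weight_def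
    by (simp add: vandermonde_def poly_prod poly_pcompose ct del: fun_upd_apply)
qed

lemma vandermonde_weight_lipschitz_one_variable:
  fixes R :: "real poly"
  assumes i: "i < n"
    and M: "\<And>x. (\<And>k. x k \<in> {0..1}) \<Longrightarrow> \<bar>vandermonde_weight n R x\<bar> \<le> M"
    and x: "\<And>k. x k \<in> {0..1}" and t: "t \<in> {0..1}"
  shows "\<bar>vandermonde_weight n R (x(i := t)) - vandermonde_weight n R x\<bar>
           \<le> 4 * M * (real (n + degree R)) ^ 3 * \<bar>t - x i\<bar>"
proof -
  obtain p where p: "degree p \<le> n - 1 + degree R" "\<And>t. poly p t = vandermonde_weight n R (x(i := t))"
    using vandermonde_weight_in_one_variable[OF i, of R x] by metis
  have "\<bar>poly p t - poly p (x i)\<bar> \<le> 4 * M * (real (n - 1 + degree R) + 1) ^ 3 * \<bar>t - x i\<bar>"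
  proof (rule poly_lipschitz_unit_interval[OF p(1)])
    fix y :: real assume "y \<in> {0..1}"
    then show "\<bar>poly p y\<bar> \<le> M" unfolding p(2) using x by (intro M) auto
  qed (use x t in auto)
  moreover have "real (n - 1 + degree R) + 1 = real (n + degree R)" using i by simp
  ultimately show ?thesis by (simp add: p(2))
qed

lemma vandermonde_weight_lipschitz:
  fixes R :: "real poly"
  assumes M: "\<And>x. (\<And>k. x k \<in> {0..1}) \<Longrightarrow> \<bar>vandermonde_weight n R x\<bar> \<le> M"
    and x: "\<And>k. x k \<in> {0..1}" and y: "\<And>k. k < n \<Longrightarrow> y k \<in> {0..1} \<and> \<bar>y k - x k\<bar> \<le> e"
  shows "\<bar>vandermonde_weight n R y - vandermonde_weight n R x\<bar>
           \<le> real n * (4 * M * (real (n + degree R)) ^ 3 * e)"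
proof -
  \<comment> \<open>\<open>h m\<close> takes its first \<open>m\<close> coordinates from
    \<open>y\<close> and the others from \<open>x\<close>. Consecutive points differ in one
    coordinate, so the one-variable bound applies \<open>n\<close> times.\<close>
  define h where "h m k = (if k < m then y k else x k)" for m k
  have M0: "M \<ge> 0" using M[of x] x by force
  have "\<bar>vandermonde_weight n R (h m) - vandermonde_weight n R x\<bar>
           \<le> real m * (4 * M * (real (n + degree R)) ^ 3 * e)" if "m \<le> n" for m
    using that
  proof (induction m)
    case 0
    then show ?case by (simp add: h_def)
  next
    case (Suc m)
    have hm: "h (Suc m) = (h m)(m := y m)" by (auto simp: h_def)
    have "\<bar>vandermonde_weight n R (h (Suc m)) - vandermonde_weight n R (h m)\<bar>
        \<le> 4 * M * (real (n + degree R)) ^ 3 * \<bar>y m - h m m\<bar>"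
      unfolding hm using Suc.prems x y
      by (intro vandermonde_weight_lipschitz_one_variable M) (auto simp: h_def)
    also have "\<dots> \<le> 4 * M * (real (n + degree R)) ^ 3 * e"
      using y[of m] Suc.prems M0 by (intro mult_left_mono) (auto simp: h_def)
    finally show ?case using Suc.IH Suc.prems by (simp add: algebra_simps)
  qed
  moreover have "vandermonde_weight n R (h n) = vandermonde_weight n R y"
    by (rule vandermonde_weight_cong) (simp add: h_def)
  ultimately show ?thesis by force
qed

text \<open>Points are functions on all of \<open>nat\<close>, so the cube is infinite dimensional
  and compact by Tychonoff. The maximum is nonzero because [0, 1] contains \<open>n\<close> distinct
  points that are not roots of \<open>R\<close>.\<close>

lemma vandermonde_weight_maximum:
  fixes R :: "real poly"
  assumes "R \<noteq> 0"
  obtains x where "\<And>k. x k \<in> {0..1}" "vandermonde_weight n R x \<noteq> 0"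
    "\<And>y. (\<And>k. y k \<in> {0..1}) \<Longrightarrow> \<bar>vandermonde_weight n R y\<bar> \<le> \<bar>vandermonde_weight n R x\<bar>"
proof -
  let ?C = "PiE UNIV (\<lambda>_. {0..1}) :: (nat \<Rightarrow> real) set"
  let ?G = "vandermonde_weight n R"
  have "compactin (product_topology (\<lambda>_. euclidean) UNIV) ?C"
    unfolding compactin_PiE by simp
  then have "compact ?C" by (simp add: euclidean_product_topology)
  moreover have "continuous_on ?C (\<lambda>x. \<bar>?G x\<bar>)"
    unfolding vandermonde_weight_def vandermonde_def
    by (intro continuous_intros continuous_on_poly continuous_on_subset[OF continuous_on_product_coordinates]) auto
  ultimately obtain x where x: "x \<in> ?C" "\<And>y. y \<in> ?C \<Longrightarrow> \<bar>?G y\<bar> \<le> \<bar>?G x\<bar>"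
    using continuous_attains_sup[of ?C "\<lambda>x. \<bar>?G x\<bar>"] by force
  have "infinite ({0..1} - {t. poly R t = 0})"
    using poly_roots_finite[OF assms] by (intro Diff_infinite_finite) (auto simp: infinite_Icc)
  then obtain T where T: "T \<subseteq> {0..1} - {t. poly R t = 0}" "card T = n" "finite T"
    using infinite_arbitrarily_large by blast
  obtain b where b: "bij_betw b {..<n} T"
    using ex_bij_betw_nat_finite[OF T(3)] T(2) by (auto simp: atLeast0LessThan)
  define y where "y k = (if k < n then b k else 0)" for k
  have "y k \<in> {0..1}" for k
    using b T(1) by (auto simp: y_def bij_betw_def)
  then have "\<bar>?G y\<bar> \<le> \<bar>?G x\<bar>" by (intro x(2)) auto
  moreover have "?G y \<noteq> 0"
  proof -
    have "y j - y i \<noteq> 0" if "i < j" "j < n" for i j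
      using that inj_on_eq_iff[OF bij_betw_imp_inj_on[OF b], of i j] by (simp add: y_def)
    moreover have "poly R (y k) \<noteq> 0" if "k < n" for k
      using b T(1) that by (auto simp: y_def bij_betw_def)
    ultimately show ?thesis by (auto simp: vandermonde_weight_def vandermonde_def)
  qed
  ultimately have "?G x \<noteq> 0" by auto
  then show ?thesis
  proof (rule that[rotated])
    show "x k \<in> {0..1}" for k using x(1) by auto
    show "\<bar>?G y\<bar> \<le> \<bar>?G x\<bar>" if "\<And>k. y k \<in> {0..1}" for y
      using that by (intro x(2)) blast
  qed
qed

lemma map_poly_of_int_mult:
  "map_poly real_of_int (p * q) = map_poly real_of_int p * map_poly real_of_int q"
  by (intro poly_eqI) (simp add: coeff_map_poly coeff_mult)

lemma map_poly_of_int_power: "map_poly real_of_int (p ^ k) = map_poly real_of_int p ^ k"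
  by (induction k) (simp_all add: map_poly_of_int_mult)

lemma map_poly_of_int_prod:
  "map_poly real_of_int (\<Prod>i\<in>I. p i) = (\<Prod>i\<in>I. map_poly real_of_int (p i))"
  by (induction I rule: infinite_finite_induct) (simp_all add: map_poly_of_int_mult)

lemma measure_unif_subinterval:
  assumes "0 \<le> a" "a + e \<le> 1" "e \<ge> 0"
  shows "measure (unif 0 1) {a..a+e} = e"
proof -
  have "ennreal (indicator {0..0+1} x / 1) * indicator {a..a+e} x = indicator {a..a+e} x" for x
    using assms by (auto split: split_indicator)
  then have "emeasure (unif 0 1) {a..a+e} = (\<integral>\<^sup>+x. indicator {a..a+e} x \<partial>lborel)"
    unfolding unif_def by (subst emeasure_density) simp_all
  then show ?thesis using assms by (simp add: measure_def)
qed

text \<open>Let \<open>Z\<close> be the mean of G^2 over the cube and \<open>Q\<close> the product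
  of the least common multiples. Then Q Z is an integer, \<open>lower\<close> makes \<open>Z\<close>
  positive, and Z \<le> M^2; hence 1 \<le> Q M^2, and taking logarithms gives the claim. The degree
  bound \<open>2 * E\<close> is that of R^2.\<close>

lemma psi_lower_bound_of_maximum:
  fixes R :: "int poly" and n E :: nat and M e :: real and a :: "nat \<Rightarrow> real"
  defines "G \<equiv> vandermonde_weight n (map_poly real_of_int R)"
  assumes R: "degree R \<le> E" and M: "M > 0" "\<And>x. (\<And>k. x k \<in> {0..1}) \<Longrightarrow> \<bar>G x\<bar> \<le> M"
    and e: "e > 0" and a: "\<And>i. i < n \<Longrightarrow> 0 \<le> a i \<and> a i + e \<le> 1"
    and lower: "\<And>x. (\<And>i. i < n \<Longrightarrow> x i \<in> {a i..a i + e}) \<Longrightarrow> \<bar>G x\<bar> \<ge> M / 2"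
  shows "- (\<Sum>j<n. chebyshev_psi (real (n + 2 * E + j))) \<le> 2 * ln M"
proof -
  let ?M = "PiM {..<n} (\<lambda>_. unif 0 1)"
  interpret product_prob_space "\<lambda>_. unif 0 1" "{..<n}"
    by (intro product_prob_spaceI prob_space_unif) simp
  have "degree (R ^ 2) \<le> 2 * E"
    using R degree_power_le[of R 2] by simp
  note S = selberg_integral[OF this, of n]
  have I: "(vandermonde n x)\<^sup>2 * (\<Prod>k<n. poly (map_poly real_of_int (R\<^sup>2)) (x k)) = (G x)\<^sup>2" for x
    unfolding G_def vandermonde_weight_def
    by (simp add: map_poly_of_int_power power_mult_distrib prod_power_distrib)
  define Z where "Z = (\<integral>x. (G x)\<^sup>2 \<partial>?M)"
  have int: "integrable ?M (\<lambda>x. (G x)\<^sup>2)"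
    and Zint: "real (\<Prod>j<n. psi_lcm (n + 2 * E + j)) * Z \<in> \<int>"
    using S unfolding I Z_def by simp_all
  have ae: "AE x in ?M. \<forall>i\<in>{..<n}. x i \<in> {0..0+1}"
    by (intro AE_finite_allI AE_PiM_component prob_space_unif AE_unif) auto
  have bound: "(G x)\<^sup>2 \<le> M\<^sup>2" if "\<forall>i\<in>{..<n}. x i \<in> {0..0+1}" for x
  proof -
    \<comment> \<open>The bound by \<open>M\<close> asks that all coordinates lie in [0, 1], while
      almost everywhere information concerns only the first \<open>n\<close>; the others are reset
      to 0.\<close>
    have "G x = G (\<lambda>k. if k < n then x k else 0)"
      unfolding G_def by (rule vandermonde_weight_cong) simp
    also have "\<bar>\<dots>\<bar> \<le> M" using that by (intro M(2)) auto
    finally show ?thesis using abs_le_square_iff[of "G x" M] M(1) by simp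
  qed
  have "Z \<le> (\<integral>x. M\<^sup>2 \<partial>?M)"
    unfolding Z_def
  proof (rule integral_mono_AE[OF int])
    show "AE x in ?M. (G x)\<^sup>2 \<le> M\<^sup>2" using ae by (rule eventually_mono) (rule bound)
  qed simp
  then have ZM: "Z \<le> M\<^sup>2" by (simp add: P.prob_space)
  let ?ind = "\<lambda>k. indicator {a k..a k+e} :: real \<Rightarrow> real"
  have ind: "integrable (unif 0 1) (?ind k)" "integral\<^sup>L (unif 0 1) (?ind k) = e" if "k < n" for k
    using measure_unif_subinterval[of "a k" e] a[OF that] e
    by (auto simp: less_top[symmetric] finite_measure.emeasure_finite[OF prob_space.finite_measure[OF prob_space_unif]])
  have "0 < (M / 2)\<^sup>2 * (\<Prod>k<n. e)" using M e by simp
  also have "\<dots> = (\<integral>x. (M / 2)\<^sup>2 * (\<Prod>k<n. ?ind k (x k)) \<partial>?M)"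
    using product_integral_prod[of "{..<n}" ?ind] ind by simp
  also have "\<dots> \<le> Z"
    unfolding Z_def
  proof (rule integral_mono[OF _ int])
    show "integrable ?M (\<lambda>x. (M / 2)\<^sup>2 * (\<Prod>k<n. ?ind k (x k)))"
      using product_integrable_prod[of "{..<n}" ?ind] ind by simp
    fix x
    show "(M / 2)\<^sup>2 * (\<Prod>k<n. ?ind k (x k)) \<le> (G x)\<^sup>2"
    proof (cases "\<forall>k<n. x k \<in> {a k..a k+e}")
      case True
      then have "(M / 2)\<^sup>2 \<le> (G x)\<^sup>2"
        using lower[of x] M(1) by (subst abs_le_square_iff[symmetric]) auto
      moreover have "(\<Prod>k<n. ?ind k (x k)) = 1" using True by (intro prod.neutral) auto
      ultimately show ?thesis by simp
    next
      case False
      then obtain k where "k < n" "x k \<notin> {a k..a k+e}" by blast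
      then have "(\<Prod>k<n. ?ind k (x k)) = 0" by (intro prod_zero) (auto intro!: bexI[of _ k])
      then show ?thesis by (metis mult_zero_right zero_le_power2)
    qed
  qed
  finally have Z0: "Z > 0" .
  define Q where "Q = real (\<Prod>j<n. psi_lcm (n + 2 * E + j))"
  have Q: "Q > 0" unfolding Q_def of_nat_prod by (intro prod_pos) (simp add: psi_lcm_pos)
  have "Q * Z \<ge> 1"
    using Zint Q Z0 unfolding Q_def[symmetric]
    by (elim Ints_cases) (metis less_le_not_le mult_pos_pos of_int_0_less_iff of_int_1_le_iff zless_imp_add1_zle add_0)
  then have "1 \<le> Q * M\<^sup>2" using ZM Q by (meson mult_le_cancel_left_pos order.trans)
  then have "0 \<le> ln (Q * M\<^sup>2)" by simp
  also have "\<dots> = ln Q + 2 * ln M" using Q M(1) by (simp add: ln_mult ln_realpow)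
  also have "ln Q = (\<Sum>j<n. chebyshev_psi (real (n + 2 * E + j)))"
    unfolding Q_def of_nat_prod by (subst ln_prod) (auto simp: psi_lcm_pos ln_psi_lcm)
  finally show ?thesis by simp
qed

lemma sum_off_diagonal_symmetric:
  fixes f :: "nat \<Rightarrow> nat \<Rightarrow> real"
  assumes sym: "\<And>i j. f i j = f j i"
  shows "(\<Sum>i<n. \<Sum>j\<in>{..<n} - {i}. f i j) = 2 * (\<Sum>j<n. \<Sum>i<j. f j i)"
proof (induction n)
  case (Suc n)
  have "(\<Sum>j\<in>{..<Suc n} - {i}. f i j) = (\<Sum>j\<in>{..<n} - {i}. f i j) + f n i" if "i < n" for i
  proof -
    have "{..<Suc n} - {i} = insert n ({..<n} - {i})" using that by auto
    then show ?thesis using sym[of i n] by simp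
  qed
  then have "(\<Sum>i<n. \<Sum>j\<in>{..<Suc n} - {i}. f i j) = (\<Sum>i<n. \<Sum>j\<in>{..<n} - {i}. f i j) + (\<Sum>i<n. f n i)"
    by (simp add: sum.distrib)
  moreover have "{..<Suc n} - {n} = {..<n}" by auto
  ultimately show ?case using Suc.IH by simp
qed simp

text \<open>The maximum \<open>M\<close> of |G| links two estimates. The sum of Chebyshev values is
  at least -2 ln M, and intervals around the coordinates of a maximum point, where |G| stays above M
  / 2, carry a measure of small weighted energy. The hypothesis \<open>dom\<close> compares
  \<open>R\<close> with the \<open>n\<close>-th power of \<open>w\<close>.\<close>

lemma weighted_V_le_psi_sum:
  fixes R :: "int poly" and n E :: nat and w :: "real \<Rightarrow> real"
  defines "R' \<equiv> map_poly real_of_int R"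
  assumes n: "n > 0" and R: "R \<noteq> 0" "degree R \<le> E"
    and w: "continuous_on {0..1} w" "w \<in> borel_measurable borel"
    and dom: "\<And>x. x \<in> {0..1} \<Longrightarrow> poly R' x \<noteq> 0 \<Longrightarrow> w x > 0 \<and> ln \<bar>poly R' x\<bar> \<le> real n * ln (w x) + C"
    and V: "weighted_V 0 1 w = ereal V"
  shows "(real n)\<^sup>2 * V \<le> (\<Sum>j<n. chebyshev_psi (real (n + 2 * E + j)))
           + real n * (8 + ln (8 * real n * real (n + E) ^ 3) + 2 * C) + 2 * ln 2"
proof -
  let ?G = "vandermonde_weight n R'"
  have R': "R' \<noteq> 0" unfolding R'_def using R(1) by (simp add: map_poly_eq_0_iff)
  have degR': "degree R' \<le> E" unfolding R'_def using R(2) map_poly_degree_leq order.trans by blast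
  obtain xs where xs: "\<And>k. xs k \<in> {0..1}" "?G xs \<noteq> 0"
    "\<And>y. (\<And>k. y k \<in> {0..1}) \<Longrightarrow> \<bar>?G y\<bar> \<le> \<bar>?G xs\<bar>"
    using vandermonde_weight_maximum[OF R', of n] by metis
  define M where "M = \<bar>?G xs\<bar>"
  have M0: "M > 0" using xs(2) by (simp add: M_def)
  have M: "\<bar>?G y\<bar> \<le> M" if "\<And>k. y k \<in> {0..1}" for y unfolding M_def using that by (rule xs(3))
  define K where "K = real (n + E) ^ 3"
  have K: "K \<ge> 1" unfolding K_def using n by (intro one_le_power) auto
  have degK: "real (n + degree R') ^ 3 \<le> K" unfolding K_def using degR' by (intro power_mono) auto
  \<comment> \<open>Chosen so that moving every coordinate by at most \<open>e\<close> changes G by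
    at most M / 2.\<close>
  define e where "e = 1 / (8 * real n * K)"
  have nK: "8 * real n * K \<ge> 1"
    using n K mult_mono[of 1 "8 * real n" 1 K] by auto
  have e: "0 < e" "e \<le> 1" using nK by (auto simp only: e_def divide_le_eq_1 intro!: divide_pos_pos)
  have lne: "- ln e = ln (8 * real n * real (n + E) ^ 3)"
    using ln_inverse[of "8 * real n * K"] unfolding e_def K_def[symmetric] inverse_eq_divide by linarith
  \<comment> \<open>The minimum shifts intervals at the right end back into [0, 1]; each still
    contains \<open>xs i\<close>.\<close>
  define a where "a i = min (xs i) (1 - e)" for i
  have a: "0 \<le> a i \<and> a i + e \<le> 1" for i using xs(1)[of i] e by (auto simp: a_def)
  have near: "t \<in> {0..1} \<and> \<bar>t - xs i\<bar> \<le> e" if "t \<in> {a i..a i+e}" for t i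
    using that xs(1)[of i] a[of i] by (auto simp: a_def)
  have lower: "\<bar>?G y\<bar> \<ge> M / 2" if "\<And>i. i < n \<Longrightarrow> y i \<in> {a i..a i+e}" for y
  proof -
    have "\<bar>?G y - ?G xs\<bar> \<le> real n * (4 * M * real (n + degree R') ^ 3 * e)"
      using that near xs(1) by (intro vandermonde_weight_lipschitz M) blast+
    also have "\<dots> \<le> real n * (4 * M * K * e)"
      using M0 e degK by (intro mult_left_mono mult_right_mono) auto
    also have "\<dots> = M / 2" using K n by (simp add: e_def field_simps)
    finally show ?thesis
      using abs_triangle_ineq2_sym[of "?G xs" "?G y"] unfolding M_def by linarith
  qed
  have extend: "(\<lambda>k. if k = i then t else a k) k \<in> {a k..a k+e}" if "t \<in> {a i..a i+e}" for t i k
    using that e by auto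
  \<comment> \<open>Completing \<open>t\<close> by the left endpoints of the other intervals gives a
    point where G is nonzero, so the factor of \<open>R\<close> at \<open>t\<close> is
    nonzero.\<close>
  have nz: "poly R' t \<noteq> 0" if "i < n" "t \<in> {a i..a i+e}" for i t
  proof -
    have "?G (\<lambda>k. if k = i then t else a k) \<noteq> 0"
      using lower[OF extend[OF that(2)]] M0 by auto
    then have "\<forall>k\<in>{..<n}. poly R' (if k = i then t else a k) \<noteq> 0"
      by (auto simp: vandermonde_weight_def)
    from bspec[OF this, of i] show ?thesis using that(1) by simp
  qed
  define \<delta> where "\<delta> = 1 / (8 * K)"
  have \<delta>: "\<delta> > 0" using K by (simp add: \<delta>_def)
  \<comment> \<open>Moving coordinate \<open>i\<close> onto coordinate \<open>j\<close> makes G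
    vanish, a change of at least M / 2. The one-variable Lipschitz bound then forces a distance of
    at least 1 / (8 K).\<close>
  have sep: "\<delta> \<le> \<bar>x - y\<bar>" if ij: "i < n" "j < n" "i \<noteq> j" and xy: "x \<in> {a i..a i+e}" "y \<in> {a j..a j+e}" for i j x y
  proof -
    define z where "z = (\<lambda>k. if k = i then x else if k = j then y else a k)"
    have z: "z k \<in> {a k..a k+e}" for k using xy e by (auto simp: z_def)
    have "?G (z(i := y)) = 0"
    proof -
      have "vandermonde n (z(i := y)) = 0"
        unfolding vandermonde_leibniz using ij
        by (intro leibniz_vandermonde_eq_0[of i n j]) (auto simp: z_def)
      then show ?thesis by (simp add: vandermonde_weight_def)
    qed
    moreover have "\<bar>?G (z(i := y)) - ?G z\<bar> \<le> 4 * M * real (n + degree R') ^ 3 * \<bar>y - z i\<bar>"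
      using near[OF z] near[OF xy(2)]
      by (intro vandermonde_weight_lipschitz_one_variable ij M) auto
    moreover have "M / 2 \<le> \<bar>?G z\<bar>" using z by (intro lower)
    ultimately have "M / 2 \<le> 4 * M * real (n + degree R') ^ 3 * \<bar>y - x\<bar>"
      by (simp add: z_def)
    also have "\<dots> \<le> 4 * M * K * \<bar>y - x\<bar>"
      using M0 degK by (intro mult_right_mono mult_left_mono) auto
    finally have "1 / 2 \<le> 4 * K * \<bar>y - x\<bar>" using M0 by (simp add: mult_ac)
    then show ?thesis using K by (simp add: \<delta>_def field_simps abs_minus_commute)
  qed
  \<comment> \<open>A compact set on which \<open>w\<close> is continuous and positive; this
    provides the bound \<open>B\<close> on the logarithm of \<open>w\<close>.\<close>
  define U where "U = (\<Union>i<n. {a i..a i+e})"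
  have "compact U" unfolding U_def by (intro compact_UN) auto
  moreover have wU: "w x > 0" if "x \<in> U" for x
    using that nz near dom unfolding U_def by blast
  then have "continuous_on U (\<lambda>x. ln (w x))"
    using near by (intro continuous_on_ln continuous_on_subset[OF w(1)]) (auto simp: U_def, force)
  ultimately have "compact ((\<lambda>x. ln (w x)) ` U)" by (intro compact_continuous_image)
  then have "bounded ((\<lambda>x. ln (w x)) ` U)" by (rule compact_imp_bounded)
  then obtain B where B: "\<And>x. x \<in> U \<Longrightarrow> \<bar>ln (w x)\<bar> \<le> B"
    by (auto simp: bounded_iff)
  \<comment> \<open>The logarithm of the lower bound M / 2 for |G|, doubled because the off-diagonal
    sum counts every pair twice, with \<open>C\<close> lost once per coordinate in replacing
    \<open>R\<close> by \<open>w\<close>.\<close>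
  define c where "c = 2 * ln (M / 2) - 2 * real n * C"
  have "weighted_V 0 1 w \<le> ereal ((real n * (8 - ln e) - c) / (real n)\<^sup>2)"
  proof (rule weighted_V_le_smeared_energy[OF n e _ w(2) _ \<delta> sep])
    show "0 \<le> a i \<and> a i + e \<le> 1" for i by (rule a)
    show "w x > 0 \<and> \<bar>ln (w x)\<bar> \<le> B" if "i < n" "x \<in> {a i..a i+e}" for i x
      using that by (intro conjI wU B) (auto simp: U_def)
    fix x assume x: "\<And>i. i < n \<Longrightarrow> x i \<in> {a i..a i+e}"
    have G: "M / 2 \<le> \<bar>?G x\<bar>" using x by (intro lower)
    then have "?G x \<noteq> 0" using M0 by auto
    then have V0: "vandermonde n x \<noteq> 0" by (auto simp: vandermonde_weight_def)
    have dist: "x j - x i \<noteq> 0" if "i < j" "j < n" for i j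
      using V0 that by (auto simp: vandermonde_def)
    have "ln (M / 2) \<le> ln \<bar>?G x\<bar>" using G M0 by simp
    also have "\<dots> = ln \<bar>vandermonde n x\<bar> + (\<Sum>k<n. ln \<bar>poly R' (x k)\<bar>)"
    proof -
      have nzx: "poly R' (x k) \<noteq> 0" if "k < n" for k using that x by (intro nz)
      then have "ln (\<Prod>k<n. \<bar>poly R' (x k)\<bar>) = (\<Sum>k<n. ln \<bar>poly R' (x k)\<bar>)"
        by (subst ln_prod) auto
      moreover have "(\<Prod>k<n. \<bar>poly R' (x k)\<bar>) > 0" using nzx by (intro prod_pos) auto
      ultimately show ?thesis
        using V0 unfolding vandermonde_weight_def abs_mult abs_prod
        by (subst ln_mult) (auto simp del: prod_zero_iff)
    qed
    also have "ln \<bar>vandermonde n x\<bar> = (\<Sum>j<n. \<Sum>i<j. ln \<bar>x j - x i\<bar>)"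
    proof -
      have "ln (\<Prod>i<j. \<bar>x j - x i\<bar>) = (\<Sum>i<j. ln \<bar>x j - x i\<bar>)" if "j < n" for j
        using dist that by (subst ln_prod) auto
      then show ?thesis
        unfolding vandermonde_def abs_prod using dist by (subst ln_prod) force+
    qed
    also have "(\<Sum>k<n. ln \<bar>poly R' (x k)\<bar>) \<le> (\<Sum>k<n. real n * ln (w (x k)) + C)"
      using x nz near by (intro sum_mono) (use dom in blast)
    also have "(\<Sum>k<n. real n * ln (w (x k)) + C) = real n * (\<Sum>k<n. ln (w (x k))) + real n * C"
      by (simp add: sum.distrib sum_distrib_left)
    finally have "2 * ln (M / 2) - 2 * real n * C \<le>
        2 * (\<Sum>j<n. \<Sum>i<j. ln \<bar>x j - x i\<bar>) + 2 * real n * (\<Sum>k<n. ln (w (x k)))"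
      by (simp add: algebra_simps)
    then show "c \<le> (\<Sum>i<n. \<Sum>j\<in>{..<n} - {i}. ln \<bar>x i - x j\<bar>) + 2 * real n * (\<Sum>i<n. ln (w (x i)))"
      by (subst sum_off_diagonal_symmetric) (auto simp: c_def abs_minus_commute)
  qed
  then have "(real n)\<^sup>2 * V \<le> real n * (8 - ln e) - c"
    using n unfolding V by (simp add: field_simps)
  moreover have "- (\<Sum>j<n. chebyshev_psi (real (n + 2 * E + j))) \<le> 2 * ln M"
    using R(2) M0 M e(1) a lower unfolding R'_def by (intro psi_lower_bound_of_maximum[of R E M n e a]) blast+
  moreover have "ln (M / 2) = ln M - ln 2" using M0 by (simp add: ln_div)
  ultimately show ?thesis
    unfolding c_def lne[symmetric] by (simp add: algebra_simps)
qed

section \<open>Summation over scales\<close>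

text \<open>Induction on the integer part of \<open>x\<close>: with n about x / (A + 1) the
  recursion leads from \<open>x\<close> down to a point y near A x / (A + 1). Since \<open>y\<close>
  is smaller than \<open>x\<close> by a fixed factor, the bounds for \<open>y\<close> leave a fixed
  proportion of the error term to absorb the loss of one step.\<close>

lemma quadratic_growth_of_recursion:
  fixes f :: "real \<Rightarrow> real" and A V s C :: real
  assumes pos: "A \<ge> 1" "V > 0" "s \<ge> 0" "C \<ge> 0"
    and mono: "\<And>x y. 1 \<le> x \<Longrightarrow> x \<le> y \<Longrightarrow> f x \<le> f y" and nonneg: "\<And>x. f x \<ge> 0"
    and rec: "\<And>n. n > 0 \<Longrightarrow> \<exists>y. A * real n \<le> y \<and> y \<le> A * real n + s \<and>
                f (y + real n) \<ge> f y + (real n)\<^sup>2 * V - C * real n * (1 + ln (real n))"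
  obtains K where "\<And>x. x \<ge> 1 \<Longrightarrow> f x \<ge> V / (2 * A + 1) * x\<^sup>2 - K * x * (1 + ln x)"
proof -
  \<comment> \<open>The constant \<open>c\<close> solves c B^2 = c A^2 + V, so the main term
    reproduces itself. The rounding of \<open>n\<close> loses at most \<open>d\<close> in
    \<open>x\<close>. The two summands of \<open>K\<close> pay for the initial range up to
    \<open>x0\<close> and for the error of one step.\<close>
  define B where "B = A + 1"
  define c where "c = V / (2 * A + 1)"
  define d where "d = s + B"
  define x0 where "x0 = d + 2 * s * B + 2 * B"
  define K where "K = c * x0 + 2 * B * (C + 2 * c * d)"
  have B: "B \<ge> 2" using pos by (simp add: B_def)
  have c: "c > 0" using pos by (simp add: c_def)
  have d: "d \<ge> 2" using pos B by (simp add: d_def)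
  have x0: "x0 \<ge> d" "x0 \<ge> 2 * s * B" "x0 \<ge> 2 * B"
    using pos B d by (auto simp: x0_def add_nonneg_nonneg)
  have K0: "K \<ge> c * x0" "K \<ge> 0" "2 * B * (C + 2 * c * d) \<le> K"
    using pos B c d x0 by (auto simp: K_def intro!: add_nonneg_nonneg mult_nonneg_nonneg)
  have "f x \<ge> c * x\<^sup>2 - K * x * (1 + ln x)" if "x \<ge> 1" for x
    using that
  proof (induction "nat \<lfloor>x\<rfloor>" arbitrary: x rule: less_induct)
    case less
    have lnx: "ln x \<ge> 0" using less.prems by simp
    show ?case
    proof (cases "x \<le> x0")
      case True
      have "c * x * x \<le> c * x0 * x" using True less.prems c by (intro mult_right_mono mult_left_mono) auto
      also have "\<dots> \<le> K * x * 1" using K0 less.prems by (simp add: mult_right_mono)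
      also have "\<dots> \<le> K * x * (1 + ln x)" using K0 less.prems lnx by (intro mult_left_mono) auto
      finally show ?thesis using nonneg[of x] by (simp add: power2_eq_square mult.assoc)
    next
      case False
      \<comment> \<open>The largest \<open>n\<close> with \<open>n * B + s\<close> at most
        \<open>x\<close>, which ensures that y + n does not pass \<open>x\<close>.\<close>
      define n where "n = nat \<lfloor>(x - s) / B\<rfloor>"
      have xd: "x \<ge> s + B" using False x0 by (simp add: d_def)
      then have ge1: "(x - s) / B \<ge> 1" using B by simp
      then have n1: "n \<ge> 1" by (simp add: n_def le_nat_floor)
      have "real n \<le> (x - s) / B" using ge1 by (simp add: n_def)
      then have n_le: "real n * B \<le> x - s" using B by (simp add: field_simps)
      have "(x - s) / B - 1 \<le> real n" using ge1 unfolding n_def by linarith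
      then have n_ge: "x - d \<le> real n * B" using B by (simp add: field_simps d_def)
      have n0: "n > 0" using n1 by simp
      obtain y where y: "A * real n \<le> y" "y \<le> A * real n + s"
        "f (y + real n) \<ge> f y + (real n)\<^sup>2 * V - C * real n * (1 + ln (real n))"
        using rec[OF n0] by blast
      have y1: "y \<ge> 1" using y(1) n1 pos mult_mono[of 1 A 1 "real n"] by auto
      have yn: "y + real n \<le> x" using y(2) n_le by (simp add: B_def algebra_simps)
      \<comment> \<open>The gap x / (2 B) is what pays for the step: multiplied by \<open>K\<close>,
        it exceeds the error (C + 2 c d) x.\<close>
      have yx: "y \<le> x - x / (2 * B)"
      proof -
        have "y \<le> (B - 1) * real n + s" using y(2) by (simp add: B_def)
        then have "B * y \<le> B * ((B - 1) * real n + s)" using B by (intro mult_left_mono) auto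
        also have "\<dots> = (B - 1) * (real n * B) + B * s" by (simp add: algebra_simps)
        also have "\<dots> \<le> (B - 1) * (x - s) + B * s" using B n_le by (intro add_mono mult_left_mono) auto
        also have "\<dots> = B * x - x + s" by (simp add: algebra_simps)
        also have "s * 1 \<le> s * B" using B pos by (intro mult_left_mono) auto
        then have "s \<le> x / 2" using False x0 by linarith
        finally have "B * y \<le> B * x - x / 2" by simp
        then show ?thesis using B by (simp add: field_simps)
      qed
      have "x / (2 * B) \<ge> 1" using False x0 B by simp
      with yx have "y \<le> x - 1" by linarith
      then have "nat \<lfloor>y\<rfloor> < nat \<lfloor>x\<rfloor>" using y1 by linarith
      then have IH: "f y \<ge> c * y\<^sup>2 - K * y * (1 + ln y)" using y1 by (rule less.hyps)
      have "c * x\<^sup>2 - 2 * c * d * x \<le> c * (x - d)\<^sup>2"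
        using c by (simp add: power2_eq_square algebra_simps)
      also have "\<dots> \<le> c * (real n * B)\<^sup>2"
        using n_ge c xd by (intro mult_left_mono power_mono) (auto simp: d_def)
      also have "\<dots> = c * (A * real n)\<^sup>2 + (real n)\<^sup>2 * (c * (2 * A + 1))"
        by (simp add: B_def power2_eq_square algebra_simps)
      also have "c * (2 * A + 1) = V" using pos by (simp add: c_def)
      also have "c * (A * real n)\<^sup>2 \<le> c * y\<^sup>2"
        using y(1) c pos by (intro mult_left_mono power_mono) auto
      finally have main: "c * x\<^sup>2 - 2 * c * d * x \<le> c * y\<^sup>2 + (real n)\<^sup>2 * V" by simp
      have nx: "real n \<le> x" using yn y1 by linarith
      have e1: "C * real n * (1 + ln (real n)) \<le> C * x * (1 + ln x)"
        using nx n1 pos less.prems by (intro mult_mono) auto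
      have yx': "y \<le> x" using yn by linarith
      have e2: "K * y * (1 + ln y) \<le> K * (x - x / (2 * B)) * (1 + ln x)"
        using yx yx' y1 K0 by (intro mult_mono mult_left_mono) auto
      have "(C + 2 * c * d) * x \<le> K * (x / (2 * B))"
        using mult_right_mono[OF K0(3), of x] B less.prems by (simp add: field_simps)
      then have "(C + 2 * c * d) * x * (1 + ln x) \<le> K * (x / (2 * B)) * (1 + ln x)"
        using lnx by (intro mult_right_mono) auto
      moreover have "2 * c * d * x * 1 \<le> 2 * c * d * x * (1 + ln x)"
        using c d less.prems lnx by (intro mult_left_mono) auto
      ultimately have "C * x * (1 + ln x) + 2 * c * d * x + K * (x - x / (2 * B)) * (1 + ln x) \<le> K * x * (1 + ln x)"
        by (simp add: algebra_simps)
      moreover have "f (y + real n) \<le> f x" using yn y1 by (intro mono) auto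
      ultimately show ?thesis using y(3) IH main e1 e2 by linarith
    qed
  qed
  then show ?thesis unfolding c_def by (rule that)
qed

text \<open>Positive exponents make the weight continuous at the roots of the polynomials too, where
  \<open>0 powr \<alpha> i\<close> is 0.\<close>

lemma poly_weight_regularity:
  fixes q :: "nat \<Rightarrow> real poly" and \<alpha> :: "nat \<Rightarrow> real"
  assumes "\<And>i. i < k \<Longrightarrow> \<alpha> i > 0"
  shows "continuous_on S (\<lambda>x. \<Prod>i<k. \<bar>poly (q i) x\<bar> powr \<alpha> i)"
    and "(\<lambda>x. \<Prod>i<k. \<bar>poly (q i) x\<bar> powr \<alpha> i) \<in> borel_measurable borel"
proof -
  have c: "continuous_on S (\<lambda>x. \<Prod>i<k. \<bar>poly (q i) x\<bar> powr \<alpha> i)" for S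
    using assms by (intro continuous_on_prod continuous_on_powr' continuous_intros) auto
  show "continuous_on S (\<lambda>x. \<Prod>i<k. \<bar>poly (q i) x\<bar> powr \<alpha> i)" by (rule c)
  show "(\<lambda>x. \<Prod>i<k. \<bar>poly (q i) x\<bar> powr \<alpha> i) \<in> borel_measurable borel"
    by (rule borel_measurable_continuous_onI[OF c])
qed

text \<open>Rounding the exponents \<alpha>_i n up to integers replaces the \<open>n\<close>-th
  power of \<open>w\<close> by an integer polynomial, at the cost of at most one bounded factor per
  index. It moves the left end n + 2E of the interval by a bounded amount; \<open>s\<close> and
  \<open>C\<close> do not depend on \<open>n\<close>.\<close>

lemma weighted_V_le_psi_integral:
  fixes k :: nat and m :: "nat \<Rightarrow> nat" and Q :: "nat \<Rightarrow> int poly"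
    and \<alpha> :: "nat \<Rightarrow> real" and w :: "real \<Rightarrow> real" and V :: real
  assumes Q: "\<And>i. i < k \<Longrightarrow> Q i \<noteq> 0" "\<And>i. i < k \<Longrightarrow> degree (Q i) \<le> m i"
    and \<alpha>: "\<And>i. i < k \<Longrightarrow> \<alpha> i > 0"
    and w: "\<And>x. w x = (\<Prod>i<k. \<bar>poly (map_poly real_of_int (Q i)) x\<bar> powr \<alpha> i)"
    and V: "weighted_V 0 1 w = ereal V"
  defines "A \<equiv> 1 + 2 * (\<Sum>i<k. \<alpha> i * real (m i))"
  shows "\<exists>s\<ge>0. \<exists>C\<ge>0. \<forall>n>0. \<exists>y. A * real n \<le> y \<and> y \<le> A * real n + s \<and>
       (real n)\<^sup>2 * V \<le> integral {y..y + real n} chebyshev_psi + C * real n * (1 + ln (real n))"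
proof -
  let ?q = "\<lambda>i. map_poly real_of_int (Q i)"
  define a where "a = (\<Sum>i<k. \<alpha> i * real (m i))"
  define s where "s = (\<Sum>i<k. real (m i))"
  have a0: "a \<ge> 0" and s0: "s \<ge> 0"
    unfolding a_def s_def using \<alpha> by (intro sum_nonneg mult_nonneg_nonneg; force intro: less_imp_le)+
  have "\<exists>B. \<forall>x\<in>{0..1}. \<bar>poly (?q i) x\<bar> \<le> B" for i
  proof -
    have "bounded (poly (?q i) ` {0..1})"
      by (intro compact_imp_bounded compact_continuous_image continuous_intros) auto
    then show ?thesis by (auto simp: bounded_iff)
  qed
  then obtain b where b: "\<And>i x. x \<in> {0..1} \<Longrightarrow> \<bar>poly (?q i) x\<bar> \<le> b i" by metis
  define C1 where "C1 = (\<Sum>i<k. ln (max 1 (b i)))"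
  have C1: "C1 \<ge> 0" by (auto simp: C1_def intro!: sum_nonneg)
  \<comment> \<open>Large enough for the constants 8 and 2 ln 2 \<le> 2n, and for the 4 ln n that
    comes from a logarithm of size O(n^4).\<close>
  define C where "C = 12 + 2 * C1 + \<bar>ln (8 * (1 + a + s) ^ 3)\<bar>"
  have w_eq: "w = (\<lambda>x. \<Prod>i<k. \<bar>poly (?q i) x\<bar> powr \<alpha> i)" using w by blast
  have wreg: "continuous_on {0..1} w" "w \<in> borel_measurable borel"
    unfolding w_eq by (intro poly_weight_regularity \<alpha>; assumption)+
  show ?thesis
  proof (rule exI[of _ "2 * s"], rule conjI[rotated], rule exI[of _ C], rule conjI[rotated], intro allI impI)
    show "0 \<le> 2 * s" "0 \<le> C" using s0 C1 by (auto simp: C_def)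
    fix n :: nat assume n: "n > 0"
    define t where "t i = nat \<lceil>\<alpha> i * real n\<rceil>" for i
    have t: "\<alpha> i * real n \<le> real (t i)" "real (t i) \<le> \<alpha> i * real n + 1" "t i > 0" if "i < k" for i
    proof -
      have "\<alpha> i * real n > 0" using \<alpha>[OF that] n by simp
      then show "\<alpha> i * real n \<le> real (t i)" "real (t i) \<le> \<alpha> i * real n + 1" "t i > 0"
        unfolding t_def by linarith+
    qed
    define R where "R = (\<Prod>i<k. Q i ^ t i)"
    define E where "E = (\<Sum>i<k. t i * m i)"
    have R0: "R \<noteq> 0" using Q(1) by (auto simp: R_def)
    have degR: "degree R \<le> E"
    proof -
      have "degree R \<le> (\<Sum>i<k. degree (Q i ^ t i))"
        unfolding R_def by (rule degree_prod_sum_le[unfolded o_def]) simp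
      also have "\<dots> \<le> E" unfolding E_def
        using Q(2) by (intro sum_mono order.trans[OF degree_power_le]) auto
      finally show ?thesis .
    qed
    have E: "real n * a \<le> real E" "real E \<le> real n * a + s"
    proof -
      have "real n * a = (\<Sum>i<k. \<alpha> i * real n * real (m i))"
        by (simp add: a_def sum_distrib_left mult_ac)
      also have "\<dots> \<le> real E" unfolding E_def of_nat_sum of_nat_mult
        using t(1) by (intro sum_mono mult_right_mono) auto
      finally show "real n * a \<le> real E" .
      have "real E \<le> (\<Sum>i<k. (\<alpha> i * real n + 1) * real (m i))"
        unfolding E_def of_nat_sum of_nat_mult using t(2) by (intro sum_mono mult_right_mono) auto
      also have "\<dots> = real n * a + s"
        by (simp add: a_def s_def sum_distrib_left sum.distrib algebra_simps)
      finally show "real E \<le> real n * a + s" .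
    qed
    have R': "poly (map_poly real_of_int R) x = (\<Prod>i<k. poly (?q i) x ^ t i)" for x
      by (simp add: R_def map_poly_of_int_prod map_poly_of_int_power poly_prod)
    have dom: "w x > 0 \<and> ln \<bar>poly (map_poly real_of_int R) x\<bar> \<le> real n * ln (w x) + C1"
      if x: "x \<in> {0..1}" and nz: "poly (map_poly real_of_int R) x \<noteq> 0" for x
    proof
      \<comment> \<open>All exponents \<open>t i\<close> are positive, so a root of any
        \<open>Q i\<close> is a root of \<open>R\<close>.\<close>
      have qnz: "poly (?q i) x \<noteq> 0" if "i < k" for i
        using nz t(3)[OF that] that unfolding R' by auto
      then show "w x > 0" unfolding w by (intro prod_pos) auto
      have "ln \<bar>poly (map_poly real_of_int R) x\<bar> = (\<Sum>i<k. real (t i) * ln \<bar>poly (?q i) x\<bar>)"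
        unfolding R' abs_prod power_abs using qnz by (subst ln_prod) (auto simp: ln_realpow)
      also have "\<dots> \<le> (\<Sum>i<k. real n * (\<alpha> i * ln \<bar>poly (?q i) x\<bar>) + ln (max 1 (b i)))"
      proof (intro sum_mono)
        fix i assume "i \<in> {..<k}"
        then have i: "i < k" by simp
        let ?u = "ln \<bar>poly (?q i) x\<bar>" and ?v = "ln (max 1 (b i))"
        have "?u \<le> ?v" using qnz[OF i] b[OF x, of i] by (subst ln_le_cancel_iff) auto
        moreover have "?v \<ge> 0" by simp
        \<comment> \<open>Rounding up leaves a difference of exponents between 0 and 1. It may thus
          be multiplied with \<open>?u\<close> \<le> \<open>?v\<close> and then replaced by 1, the
          maximum with 1 making \<open>?v\<close> nonnegative.\<close>
        ultimately have "(real (t i) - \<alpha> i * real n) * ?u \<le> 1 * ?v"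
          using t(1,2)[OF i] mult_left_mono[of ?u ?v "real (t i) - \<alpha> i * real n"]
            mult_right_mono[of "real (t i) - \<alpha> i * real n" 1 ?v] by linarith
        then show "real (t i) * ?u \<le> real n * (\<alpha> i * ?u) + ?v" by (simp add: algebra_simps)
      qed
      also have "\<dots> = real n * (\<Sum>i<k. \<alpha> i * ln \<bar>poly (?q i) x\<bar>) + C1"
        by (simp add: sum.distrib sum_distrib_left C1_def)
      also have "(\<Sum>i<k. \<alpha> i * ln \<bar>poly (?q i) x\<bar>) = ln (w x)"
        unfolding w using qnz by (subst ln_prod) (auto simp: ln_powr)
      finally show "ln \<bar>poly (map_poly real_of_int R) x\<bar> \<le> real n * ln (w x) + C1" .
    qed
    define y where "y = real (n + 2 * E)"
    have "(real n)\<^sup>2 * V \<le> (\<Sum>j<n. chebyshev_psi (real (n + 2 * E + j)))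
           + real n * (8 + ln (8 * real n * real (n + E) ^ 3) + 2 * C1) + 2 * ln 2"
      by (rule weighted_V_le_psi_sum[OF n R0 degR wreg dom V])
    moreover have "(\<Sum>j<n. chebyshev_psi (real (n + 2 * E + j))) \<le> integral {y..y + real n} chebyshev_psi"
      using sum_chebyshev_psi_le_integral[where n = n and a = y] by (simp add: y_def)
    moreover have "real n * (8 + ln (8 * real n * real (n + E) ^ 3) + 2 * C1) + 2 * ln 2 \<le> C * real n * (1 + ln (real n))"
    proof -
      have "s * 1 \<le> s * real n" using s0 n by (intro mult_left_mono) auto
      then have "real (n + E) \<le> real n * (1 + a + s)" using E(2) by (simp add: algebra_simps)
      then have "8 * real n * real (n + E) ^ 3 \<le> 8 * real n * (real n * (1 + a + s)) ^ 3"
        by (intro mult_left_mono power_mono) auto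
      also have "\<dots> = real n ^ 4 * (8 * (1 + a + s) ^ 3)"
        by (simp add: power_mult_distrib eval_nat_numeral)
      finally have "ln (8 * real n * real (n + E) ^ 3) \<le> ln (real n ^ 4 * (8 * (1 + a + s) ^ 3))"
        using n by (subst ln_le_cancel_iff) (use a0 s0 in auto)
      also have "\<dots> = 4 * ln (real n) + ln (8 * (1 + a + s) ^ 3)"
        using n a0 s0 by (subst ln_mult) (auto simp: ln_realpow)
      finally have l: "ln (8 * real n * real (n + E) ^ 3) \<le> 4 * ln (real n) + \<bar>ln (8 * (1 + a + s) ^ 3)\<bar>"
        by linarith
      have ln0: "ln (real n) \<ge> 0" using n by simp
      have "(4::real) \<le> C" "10 + 2 * C1 + \<bar>ln (8 * (1 + a + s) ^ 3)\<bar> \<le> C" using C1 by (auto simp: C_def)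
      with l have "10 + ln (8 * real n * real (n + E) ^ 3) + 2 * C1 \<le> C + C * ln (real n)"
        using mult_right_mono[of 4 C "ln (real n)"] ln0 by linarith
      then have "real n * (10 + ln (8 * real n * real (n + E) ^ 3) + 2 * C1) \<le> real n * (C + C * ln (real n))"
        by (intro mult_left_mono) auto
      moreover have "2 * ln 2 \<le> 2 * real n"
        using ln_2_less_1 n by (intro mult_left_mono) auto
      ultimately show ?thesis by (simp add: algebra_simps)
    qed
    ultimately have "(real n)\<^sup>2 * V \<le> integral {y..y + real n} chebyshev_psi + C * real n * (1 + ln (real n))"
      by linarith
    moreover have "A * real n \<le> y" "y \<le> A * real n + 2 * s"
      using E by (auto simp: A_def y_def a_def[symmetric] algebra_simps)
    ultimately show "\<exists>y. A * real n \<le> y \<and> y \<le> A * real n + 2 * s \<and>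
       (real n)\<^sup>2 * V \<le> integral {y..y + real n} chebyshev_psi + C * real n * (1 + ln (real n))"
      by blast
  qed
qed

theorem theorem1p1:
  fixes k :: nat and m :: "nat \<Rightarrow> nat" and Q :: "nat \<Rightarrow> int poly"
    and \<alpha> :: "nat \<Rightarrow> real" and w :: "real \<Rightarrow> real"
  assumes "k \<ge> 1"
    and "\<And>i. i < k \<Longrightarrow> Q i \<noteq> 0"
    and "\<And>i. i < k \<Longrightarrow> degree (Q i) \<le> m i"
    and "\<And>i. i < k \<Longrightarrow> \<alpha> i > 0"
    and "\<And>x. w x = (\<Prod>i<k. \<bar>poly (map_poly real_of_int (Q i)) x\<bar> powr \<alpha> i)"
  shows "\<exists>g. g \<in> O(\<lambda>x. x * (ln x)\<^sup>2) \<and>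
           (\<forall>\<^sub>F x in at_top.
              integral {1..x} chebyshev_psi \<ge>
                (- 2 * ln (weighted_cap 0 1 w)) / (4 * (\<Sum>i<k. \<alpha> i * real (m i)) + 3) * x\<^sup>2 / 2
                + g x)"
proof -
  define a where "a = (\<Sum>i<k. \<alpha> i * real (m i))"
  define f where "f x = integral {1..x} chebyshev_psi" for x
  have a0: "a \<ge> 0"
    unfolding a_def using assms(4) by (intro sum_nonneg mult_nonneg_nonneg) (auto intro: less_imp_le)
  have f0: "f x \<ge> 0" for x
    unfolding f_def by (intro integral_nonneg chebyshev_psi_integrable chebyshev_psi_nonneg)
  \<comment> \<open>The first case includes an infinite \<open>V\<^sub>w\<close>: the capacity is then \<open>0\<close> and \<open>ln 0 = 0\<close>.\<close>
  show ?thesis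
  proof (cases "- ln (weighted_cap 0 1 w) \<le> 0")
    case True
    then have "(- 2 * ln (weighted_cap 0 1 w)) / (4 * a + 3) * x\<^sup>2 / 2 \<le> 0" for x
      using a0 by (intro divide_nonpos_nonneg mult_nonpos_nonneg) auto
    then have "integral {1..x} chebyshev_psi \<ge> (- 2 * ln (weighted_cap 0 1 w)) / (4 * a + 3) * x\<^sup>2 / 2 + 0" for x
      using f0[of x] unfolding f_def by (metis add.right_neutral order.trans)
    then show ?thesis
      unfolding a_def by (intro exI[of _ "\<lambda>_. 0"] conjI always_eventually allI) simp_all
  next
    case False
    then obtain V where V: "weighted_V 0 1 w = ereal V"
      by (cases "weighted_V 0 1 w") (auto simp: weighted_cap_def)
    then have cap: "ln (weighted_cap 0 1 w) = - V" by (simp add: weighted_cap_def)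
    with False have V0: "V > 0" by simp
    obtain s C where sC: "s \<ge> 0" "C \<ge> 0"
      "\<And>n. n > 0 \<Longrightarrow> \<exists>y. (1 + 2 * a) * real n \<le> y \<and> y \<le> (1 + 2 * a) * real n + s \<and>
         (real n)\<^sup>2 * V \<le> integral {y..y + real n} chebyshev_psi + C * real n * (1 + ln (real n))"
      using weighted_V_le_psi_integral[OF assms(2-5) V, folded a_def] by blast
    have comb: "f x + integral {x..y} chebyshev_psi = f y" if "1 \<le> x" "x \<le> y" for x y
      unfolding f_def using that
      by (intro Henstock_Kurzweil_Integration.integral_combine chebyshev_psi_integrable)
    have int0: "integral {x..y} chebyshev_psi \<ge> 0" for x y
      by (intro integral_nonneg chebyshev_psi_integrable chebyshev_psi_nonneg)
    \<comment> \<open>With \<open>A = 1 + 2 * a\<close> the denominator \<open>2 * A + 1\<close> is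
      \<open>4 * a + 3\<close>.\<close>
    obtain K where K: "\<And>x. x \<ge> 1 \<Longrightarrow> f x \<ge> V / (2 * (1 + 2 * a) + 1) * x\<^sup>2 - K * x * (1 + ln x)"
    proof (rule quadratic_growth_of_recursion[of "1 + 2 * a" V s C f])
      show "f x \<le> f y" if "1 \<le> x" "x \<le> y" for x y
        using comb[OF that] int0[of x y] by linarith
      fix n :: nat assume n: "n > 0"
      obtain y where y: "(1 + 2 * a) * real n \<le> y" "y \<le> (1 + 2 * a) * real n + s"
         "(real n)\<^sup>2 * V \<le> integral {y..y + real n} chebyshev_psi + C * real n * (1 + ln (real n))"
        using sC(3)[OF n] by blast
      have "1 \<le> y" using y(1) n a0 mult_mono[of 1 "1 + 2 * a" 1 "real n"] by auto
      then show "\<exists>y. (1 + 2 * a) * real n \<le> y \<and> y \<le> (1 + 2 * a) * real n + s \<and>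
          f y + (real n)\<^sup>2 * V - C * real n * (1 + ln (real n)) \<le> f (y + real n)"
        using y comb[of y "y + real n"] by (intro exI[of _ y]) auto
    qed (use a0 V0 sC f0 in auto)
    show ?thesis
    \<comment> \<open>The error obtained is O(x ln x), within the claimed O(x (ln x)^2).\<close>
    proof (intro exI[of _ "\<lambda>x. - (K * x * (1 + ln x))"] conjI)
      show "(\<lambda>x. - (K * x * (1 + ln x))) \<in> O(\<lambda>x. x * (ln x)\<^sup>2)" by real_asymp
      show "\<forall>\<^sub>F x in at_top. integral {1..x} chebyshev_psi \<ge>
          (- 2 * ln (weighted_cap 0 1 w)) / (4 * (\<Sum>i<k. \<alpha> i * real (m i)) + 3) * x\<^sup>2 / 2
            + - (K * x * (1 + ln x))"
        using eventually_ge_at_top[of 1]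
      proof eventually_elim
        case (elim x)
        have "(- 2 * (- V)) / (4 * a + 3) * x\<^sup>2 / 2 = V / (2 * (1 + 2 * a) + 1) * x\<^sup>2"
          using a0 by (simp add: divide_simps)
        with K[OF elim] show ?case unfolding cap f_def a_def[symmetric] by linarith
      qed
    qed
  qed
qed

end
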